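(* Let $n\ge 2$ and let $\Pi_0,\dots,\Pi_n\subset\mathbb{P}^n$ be general linear subspaces of codimension $2$. With the linear forms $g_k$ and the matrices $C_i$ defined in the context, let $\Pi_k^*\subset\mathbb{P}^n$, $k=0,\dots,n$, be the codimension $2$ linear subspace (of the projective space with homogeneous coordinates $y_0,\dots,y_n$) defined by the ideal $(y_k,g_k)$. Then the forms $\det(C_i)$, $i=0,\dots,n$, which define the inverse $u_n$ of $v_n$, have degree $n$ and vanish on the $n+1$ codimension $2$ linear subspaces $\Pi_0^*,\dots,\Pi_n^*$.
   Context: $\mathbb{P}^n$ is projective space over a ground field $K$ of characteristic $0$; points and lines are understood geometrically (i.e. over an algebraic closure if $K$ is not algebraically closed). "General" means: for all choices in some dense Zariski-open subset of the parameter space. Coordinates $x_0,\dots,x_n$ on $\mathbb{P}^n$ are chosen so that the ideal of $\Pi_i$ is $(x_i,f_i)$ with $f_i=\sum_{j\neq i}a_{i,j}x_j$ and $a_{i,j}\neq 0$ for all $i\neq j$. Let $B$ be the $(n+1)\times(n+1)$ matrix, with rows and columns indexed by $0,\dots,n$, whose $(i,i)$ entry is $-f_i$ and whose $(i,j)$ entry for $i\ne j$ is $a_{i,j}x_j$; let $B_i$ be obtained from $B$ by deleting row $i$ and column $i$. Then $\det(B_i)=x_iQ_i$, where $Q_i$ is a form of degree $n-1$ defining the unique hypersurface of degree $n-1$ containing all $\Pi_j$ with $j\neq i$. $\mathcal{L}_n$ is the vector space of forms of degree $n$ vanishing on $\Pi_0\cup\dots\cup\Pi_n$; the forms $x_0Q_0,\dots,x_nQ_n$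 are a basis of it. The rational map $v_n:\mathbb{P}^n\dashrightarrow\mathbb{P}^n$ is $(x_0:\dots:x_n)\mapsto(x_0Q_0:\dots:x_nQ_n)$, the target having homogeneous coordinates $y_0,\dots,y_n$. Since $f_iQ_i\in\mathcal{L}_n$, there are unique scalars $b_{i,j}$ with $f_iQ_i=b_{i,0}x_0Q_0+\dots+b_{i,n}x_nQ_n$; put $g_i=b_{i,0}y_0+\dots+b_{i,n}y_n$. Let $C$ be the $(n+1)\times(n+1)$ matrix whose $(i,i)$ entry is $-g_i$ and whose $(i,j)$ entry for $i\neq j$ is $a_{i,j}y_j$, and let $C_i$ be obtained from $C$ by deleting row $i$ and column $i$. The map $u_n$ is $(y_0:\dots:y_n)\mapsto(\det C_0:\dots:\det C_n)$; it is a birational map inverse to $v_n$. *)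

theory Defs
  imports
    "HOL-Library.Poly_Mapping"
    "HOL-Library.FuncSet"
    "HOL-Algebra.Algebraic_Closure_Type"
    "Jordan_Normal_Form.Determinant"
begin

section \<open>Polynomials in several variables\<close>

text \<open>Exponent vectors are finitely supported functions on the type of variables; the product
  of \<open>poly_mapping\<close> is convolution, i.e. polynomial multiplication.\<close>

type_synonym ('v, 'k) mpoly = "('v \<Rightarrow>\<^sub>0 nat) \<Rightarrow>\<^sub>0 'k"

definition Cst :: "'k::zero \<Rightarrow> ('v, 'k) mpoly" where
  "Cst c = Poly_Mapping.single 0 c"

definition Var :: "'v \<Rightarrow> ('v, 'k::zero_neq_one) mpoly" where
  "Var v = Poly_Mapping.single (Poly_Mapping.single v 1) 1"

text \<open>\<open>mpeval h p F\<close> sends the variable \<open>v\<close> to \<open>p v\<close> and applies the (intended) ring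
  homomorphism \<open>h\<close> to the coefficients. With \<open>h = Cst\<close> this is substitution of polynomials.\<close>

definition mpeval :: "('k::zero \<Rightarrow> 'b::comm_ring_1) \<Rightarrow> ('v \<Rightarrow> 'b) \<Rightarrow> ('v, 'k) mpoly \<Rightarrow> 'b" where
  "mpeval h p F = (\<Sum>m\<in>Poly_Mapping.keys F. h (Poly_Mapping.lookup F m) *
     (\<Prod>v\<in>Poly_Mapping.keys m. p v ^ Poly_Mapping.lookup m v))"

text \<open>The polynomial ring \<open>K[x\<^sub>0,\<dots>,x\<^sub>n]\<close> and its forms of degree \<open>d\<close> (including \<open>0\<close>).\<close>

definition polys :: "nat \<Rightarrow> (nat, 'k::zero) mpoly set" where
  "polys n = {F. \<forall>m\<in>Poly_Mapping.keys F. Poly_Mapping.keys m \<subseteq> {..n}}"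

definition forms :: "nat \<Rightarrow> nat \<Rightarrow> (nat, 'k::zero) mpoly set" where
  "forms n d = {F \<in> polys n.
     \<forall>m\<in>Poly_Mapping.keys F. (\<Sum>v\<in>Poly_Mapping.keys m. Poly_Mapping.lookup m v) = d}"

definition ideal_of_two :: "nat \<Rightarrow> (nat, 'k::comm_ring_1) mpoly \<Rightarrow> (nat, 'k) mpoly
    \<Rightarrow> (nat, 'k) mpoly set" where
  "ideal_of_two n F G = {P * F + R * G | P R. P \<in> polys n \<and> R \<in> polys n}"


section \<open>Projective space and linear subspaces\<close>

text \<open>Geometric points of \<open>\<bbbP>\<^sup>n\<close> over \<open>K\<close> are given by vectors of homogeneous coordinates in the
  algebraic closure of \<open>K\<close>, indexed by \<open>{..n}\<close> and padded by \<open>0\<close>. A subset of \<open>\<bbbP>\<^sup>n\<close> is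
  represented by the set of all homogeneous coordinate vectors of its points.\<close>

definition proj_points :: "nat \<Rightarrow> (nat \<Rightarrow> 'k::field alg_closure) set" where
  "proj_points n = {p. (\<forall>i>n. p i = 0) \<and> (\<exists>i\<le>n. p i \<noteq> 0)}"

definition zero_locus :: "nat \<Rightarrow> (nat, 'k::field) mpoly set \<Rightarrow> (nat \<Rightarrow> 'k alg_closure) set" where
  "zero_locus n S = {p \<in> proj_points n. \<forall>F\<in>S. mpeval to_ac p F = 0}"

definition vanishing_ideal :: "nat \<Rightarrow> (nat \<Rightarrow> 'k::field alg_closure) set
    \<Rightarrow> (nat, 'k) mpoly set" where
  "vanishing_ideal n Z = {F \<in> polys n. \<forall>p\<in>Z. mpeval to_ac p F = 0}"

definition lin_form :: "nat \<Rightarrow> (nat \<Rightarrow> 'k::comm_ring_1) \<Rightarrow> (nat, 'k) mpoly" where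
  "lin_form n l = (\<Sum>j\<le>n. Cst (l j) * Var j)"

definition lin_indep2 :: "nat \<Rightarrow> (nat \<Rightarrow> 'k::field) \<Rightarrow> (nat \<Rightarrow> 'k) \<Rightarrow> bool" where
  "lin_indep2 n l m \<longleftrightarrow> (\<forall>s t. (\<forall>j\<le>n. s * l j + t * m j = 0) \<longrightarrow> s = 0 \<and> t = 0)"

definition codim2_subspaces :: "nat \<Rightarrow> (nat \<Rightarrow> 'k::field alg_closure) set set" where
  "codim2_subspaces n =
     {zero_locus n {lin_form n l, lin_form n m} | l m. lin_indep2 n l m}"

text \<open>Homogeneous coordinates: \<open>T\<close> expresses the new coordinates in terms of the given ones.\<close>

definition coord_change :: "nat \<Rightarrow> 'k::field mat \<Rightarrow> (nat \<Rightarrow> 'k alg_closure)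
    \<Rightarrow> (nat \<Rightarrow> 'k alg_closure)" where
  "coord_change n T p = (\<lambda>i. if i \<le> n then \<Sum>j\<le>n. to_ac (T $$ (i, j)) * p j else 0)"


section \<open>General tuples of codimension 2 subspaces\<close>

text \<open>The parameter space consists of the \<open>(n+1)\<close>-tuples of codimension 2 linear subspaces, i.e. it
  is a product of \<open>n+1\<close> Grassmannians.\<close>

definition tuples :: "nat \<Rightarrow> (nat \<Rightarrow> (nat \<Rightarrow> 'k::field alg_closure) set) set" where
  "tuples n = (\<Pi>\<^sub>E i\<in>{..n}. codim2_subspaces n)"

text \<open>A frame lists, for each \<open>i \<le> n\<close>, two independent linear forms defining the \<open>i\<close>-th
  subspace: \<open>c (i, e, j)\<close> is the \<open>j\<close>-th coefficient of the \<open>e\<close>-th form (\<open>e = 0, 1\<close>).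
  The Zariski topology on a product of Grassmannians is the quotient of the Zariski topology on
  the open set of frames in affine space.\<close>

definition frames :: "nat \<Rightarrow> (nat \<times> nat \<times> nat \<Rightarrow> 'k::field) set" where
  "frames n = {c. (\<forall>v. v \<notin> {..n} \<times> {..1} \<times> {..n} \<longrightarrow> c v = 0) \<and>
                  (\<forall>i\<le>n. lin_indep2 n (\<lambda>j. c (i, 0, j)) (\<lambda>j. c (i, 1, j)))}"

definition tuple_of_frame :: "nat \<Rightarrow> (nat \<times> nat \<times> nat \<Rightarrow> 'k::field)
    \<Rightarrow> (nat \<Rightarrow> (nat \<Rightarrow> 'k alg_closure) set)" where
  "tuple_of_frame n c =
     (\<lambda>i\<in>{..n}. zero_locus n {lin_form n (\<lambda>j. c (i, 0, j)), lin_form n (\<lambda>j. c (i, 1, j))})"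

definition zariski_open :: "nat \<Rightarrow> (nat \<Rightarrow> (nat \<Rightarrow> 'k::field alg_closure) set) set \<Rightarrow> bool" where
  "zariski_open n U \<longleftrightarrow> U \<subseteq> tuples n \<and>
     (\<exists>S :: (nat \<times> nat \<times> nat, 'k) mpoly set.
        {c \<in> frames n. tuple_of_frame n c \<in> U} =
        {c \<in> frames n. \<exists>F\<in>S. mpeval (\<lambda>a. a) c F \<noteq> 0})"

definition zariski_dense :: "nat \<Rightarrow> (nat \<Rightarrow> (nat \<Rightarrow> 'k::field alg_closure) set) set \<Rightarrow> bool" where
  "zariski_dense n U \<longleftrightarrow> (\<forall>V. zariski_open n V \<and> V \<noteq> {} \<longrightarrow> U \<inter> V \<noteq> {})"


section \<open>The forms and matrices attached to the coefficients \<open>a\<^sub>i\<^sub>,\<^sub>j\<close>\<close>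

definition f_form :: "nat \<Rightarrow> (nat \<Rightarrow> nat \<Rightarrow> 'k::field) \<Rightarrow> nat \<Rightarrow> (nat, 'k) mpoly" where
  "f_form n a i = (\<Sum>j\<in>{..n} - {i}. Cst (a i j) * Var j)"

definition adapted_coords :: "nat \<Rightarrow> (nat \<Rightarrow> (nat \<Rightarrow> 'k::field alg_closure) set)
    \<Rightarrow> 'k mat \<Rightarrow> (nat \<Rightarrow> nat \<Rightarrow> 'k) \<Rightarrow> bool" where
  "adapted_coords n P T a \<longleftrightarrow>
     T \<in> carrier_mat (n + 1) (n + 1) \<and> invertible_mat T \<and>
     (\<forall>i\<le>n. vanishing_ideal n (coord_change n T ` P i)
              = ideal_of_two n (Var i) (f_form n a i)) \<and>
     (\<forall>i\<le>n. \<forall>j\<le>n. i \<noteq> j \<longrightarrow> a i j \<noteq> 0)"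

definition B_mat :: "nat \<Rightarrow> (nat \<Rightarrow> nat \<Rightarrow> 'k::field) \<Rightarrow> (nat, 'k) mpoly mat" where
  "B_mat n a = mat (n + 1) (n + 1)
     (\<lambda>(i, j). if i = j then - f_form n a i else Cst (a i j) * Var j)"

definition Q_form :: "nat \<Rightarrow> (nat \<Rightarrow> nat \<Rightarrow> 'k::field) \<Rightarrow> nat \<Rightarrow> (nat, 'k) mpoly" where
  "Q_form n a i = (THE Q. det (mat_delete (B_mat n a) i i) = Var i * Q)"

definition v_map :: "nat \<Rightarrow> (nat \<Rightarrow> nat \<Rightarrow> 'k::field) \<Rightarrow> nat \<Rightarrow> (nat, 'k) mpoly" where
  "v_map n a i = Var i * Q_form n a i"

text \<open>\<open>is_b_row n a i \<beta>\<close>: \<open>\<beta>\<close> is the coefficient vector (padded by \<open>0\<close>) of \<open>f\<^sub>i Q\<^sub>i\<close> in terms of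
  \<open>x\<^sub>0 Q\<^sub>0, \<dots>, x\<^sub>n Q\<^sub>n\<close>.\<close>

definition is_b_row :: "nat \<Rightarrow> (nat \<Rightarrow> nat \<Rightarrow> 'k::field) \<Rightarrow> nat \<Rightarrow> (nat \<Rightarrow> 'k) \<Rightarrow> bool" where
  "is_b_row n a i \<beta> \<longleftrightarrow> (\<forall>j>n. \<beta> j = 0) \<and>
     f_form n a i * Q_form n a i = (\<Sum>j\<le>n. Cst (\<beta> j) * (Var j * Q_form n a j))"

definition b_coeff :: "nat \<Rightarrow> (nat \<Rightarrow> nat \<Rightarrow> 'k::field) \<Rightarrow> nat \<Rightarrow> nat \<Rightarrow> 'k" where
  "b_coeff n a i = (THE \<beta>. is_b_row n a i \<beta>)"

text \<open>From here on \<open>Var j\<close> plays the role of the coordinate \<open>y\<^sub>j\<close> of the target of \<open>v\<^sub>n\<close>.\<close>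

definition g_form :: "nat \<Rightarrow> (nat \<Rightarrow> nat \<Rightarrow> 'k::field) \<Rightarrow> nat \<Rightarrow> (nat, 'k) mpoly" where
  "g_form n a i = (\<Sum>j\<le>n. Cst (b_coeff n a i j) * Var j)"

definition C_mat :: "nat \<Rightarrow> (nat \<Rightarrow> nat \<Rightarrow> 'k::field) \<Rightarrow> (nat, 'k) mpoly mat" where
  "C_mat n a = mat (n + 1) (n + 1)
     (\<lambda>(i, j). if i = j then - g_form n a i else Cst (a i j) * Var j)"

definition u_map :: "nat \<Rightarrow> (nat \<Rightarrow> nat \<Rightarrow> 'k::field) \<Rightarrow> nat \<Rightarrow> (nat, 'k) mpoly" where
  "u_map n a i = det (mat_delete (C_mat n a) i i)"

definition Pi_star :: "nat \<Rightarrow> (nat \<Rightarrow> nat \<Rightarrow> 'k::field) \<Rightarrow> nat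
    \<Rightarrow> (nat \<Rightarrow> 'k alg_closure) set" where
  "Pi_star n a k = zero_locus n (ideal_of_two n (Var k) (g_form n a k))"


section \<open>Rational self-maps of projective space\<close>

text \<open>Tuples \<open>(F\<^sub>0 : \<dots> : F\<^sub>n)\<close> and \<open>(G\<^sub>0 : \<dots> : G\<^sub>n)\<close> define the same rational map iff both are
  nonzero and their \<open>2 \<times> 2\<close> minors vanish.\<close>

definition same_rat_map :: "nat \<Rightarrow> (nat \<Rightarrow> (nat, 'k::field) mpoly)
    \<Rightarrow> (nat \<Rightarrow> (nat, 'k) mpoly) \<Rightarrow> bool" where
  "same_rat_map n F G \<longleftrightarrow> (\<exists>i\<le>n. F i \<noteq> 0) \<and> (\<exists>i\<le>n. G i \<noteq> 0) \<and>
     (\<forall>i\<le>n. \<forall>j\<le>n. F i * G j = F j * G i)"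

definition rat_comp :: "(nat \<Rightarrow> (nat, 'k::field) mpoly) \<Rightarrow> (nat \<Rightarrow> (nat, 'k) mpoly)
    \<Rightarrow> nat \<Rightarrow> (nat, 'k) mpoly" where
  "rat_comp F G = (\<lambda>i. mpeval Cst G (F i))"

definition mutually_inverse :: "nat \<Rightarrow> (nat \<Rightarrow> (nat, 'k::field) mpoly)
    \<Rightarrow> (nat \<Rightarrow> (nat, 'k) mpoly) \<Rightarrow> bool" where
  "mutually_inverse n F G \<longleftrightarrow>
     same_rat_map n (rat_comp F G) Var \<and> same_rat_map n (rat_comp G F) Var"

end

theory Submission
  imports Defs
begin

text \<open>
  \<^bold>\<open>The determinants.\<close> The rows of \<open>B\<close> sum to zero: up to sign, \<open>B\<close> is the Laplacian of a weighted
  directed graph. Therefore all cofactors along a row of \<open>B\<close> agree, and the principal minors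
  \<open>w\<^sub>i = det B\<^sub>i\<close> span the left kernel of \<open>B\<close>. In coordinates this says
  \<open>w\<^sub>j f\<^sub>j = x\<^sub>j \<Sum>\<^sub>i\<^sub>\<noteq>\<^sub>j a\<^sub>i\<^sub>j w\<^sub>i\<close> (\<open>lap_minor_balance\<close>), and these relations determine \<open>w\<close> up to a common factor
  (\<open>lap_minor_unique\<close>). The agreement of cofactors also shows that \<open>x\<^sub>i\<close> divides \<open>w\<^sub>i\<close>
  (\<open>coordinate_dvd_lap_minor\<close>). Cancelling \<open>x\<^sub>j\<close> in the balance relation gives
  \<open>f\<^sub>j Q\<^sub>j = \<Sum>\<^sub>i\<^sub>\<noteq>\<^sub>j a\<^sub>i\<^sub>j x\<^sub>i Q\<^sub>i\<close>, so the scalars of the theorem are simply \<open>b\<^sub>j\<^sub>,\<^sub>i = a\<^sub>i\<^sub>,\<^sub>j\<close> and \<open>b\<^sub>j\<^sub>,\<^sub>j = 0\<close>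
  (\<open>is_b_row_iff\<close>): \<open>g\<^sub>j\<close> is the form \<open>f\<^sub>j\<close> attached to the transposed weights. Hence \<open>C\<close> is conjugate, by the
  diagonal matrix of the \<open>y\<^sub>i\<close>, to the transpose of the matrix \<open>B\<close> of the transposed weights, and
  \<^emph>\<open>the map \<open>u\<close> is the map \<open>v\<close> of the transposed weights\<close> (\<open>u_map_eq\<close>). The degree of \<open>det C\<^sub>i\<close> is then clear.
  It vanishes on \<open>\<Pi>\<^sub>k\<^sup>*\<close> because there the column \<open>k\<close> of the transposed weight matrix is zero if \<open>i \<noteq> k\<close>, and
  because \<open>y\<^sub>k\<close> divides \<open>det C\<^sub>k\<close>. The maps are mutually inverse because \<open>x\<close> and \<open>u(v(x))\<close> both solve
  the balance relations of the transposed weights at \<open>v(x)\<close>, whose solution is unique up to a factor.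

  \<^bold>\<open>General position.\<close> The open set consists of all tuples that admit adapted coordinates. The argument above
  applies to each of them, because the \<open>a\<^sub>i\<^sub>,\<^sub>j\<close> are nonzero. Adapted coordinates amount to a choice of two
  hyperplanes \<open>x\<^sub>i\<close> and \<open>f\<^sub>i\<close> through each subspace such that the \<open>x\<^sub>i\<close> form a basis in which \<open>f\<^sub>i\<close> has nonzero
  coefficients off \<open>x\<^sub>i\<close>. By Cramer's rule this is the nonvanishing of a polynomial in the
  coefficients of a frame, one polynomial for each choice (\<open>genericity_sufficient\<close>, \<open>genericity_necessary\<close>).
  The passage between the vanishing ideals, in terms of which adapted coordinates are
  defined, and the pencils of hyperplanes rests on \<open>vanishing_linear_form\<close> and
  \<open>vanishing_ideal_weight_plane\<close>. Density follows by restricting polynomials to lines in the space of frames.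
\<close>


section \<open>Evaluation of polynomials\<close>

definition mon_eval :: "('v \<Rightarrow> 'b::comm_ring_1) \<Rightarrow> ('v \<Rightarrow>\<^sub>0 nat) \<Rightarrow> 'b" where
  "mon_eval p m = (\<Prod>v\<in>Poly_Mapping.keys m. p v ^ Poly_Mapping.lookup m v)"

lemma mon_eval_superset:
  assumes "finite S" "Poly_Mapping.keys m \<subseteq> S"
  shows "mon_eval p m = (\<Prod>v\<in>S. p v ^ Poly_Mapping.lookup m v)"
  unfolding mon_eval_def
  by (rule prod.mono_neutral_left) (use assms in \<open>auto simp: in_keys_iff\<close>)

lemma mon_eval_0 [simp]: "mon_eval p 0 = 1"
  by (simp add: mon_eval_def)

lemma mon_eval_add: "mon_eval p (m + m') = mon_eval p m * mon_eval p m'"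
proof -
  let ?S = "Poly_Mapping.keys m \<union> Poly_Mapping.keys m'"
  have "Poly_Mapping.keys (m + m') \<subseteq> ?S" by (rule keys_add)
  then show ?thesis
    by (simp add: mon_eval_superset[of ?S] lookup_add power_add prod.distrib)
qed

lemma mon_eval_single [simp]: "mon_eval p (Poly_Mapping.single v k) = p v ^ k"
  by (simp add: mon_eval_superset[of "{v}"])

lemma mpeval_superset:
  assumes "h 0 = 0" "finite S" "Poly_Mapping.keys F \<subseteq> S"
  shows "mpeval h p F = (\<Sum>m\<in>S. h (Poly_Mapping.lookup F m) * mon_eval p m)"
  unfolding mpeval_def mon_eval_def
  by (rule sum.mono_neutral_left) (use assms in \<open>auto simp: in_keys_iff\<close>)

lemma sum_of_terms:
  fixes F :: "_ \<Rightarrow>\<^sub>0 _::comm_monoid_add"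
  shows
  "F = (\<Sum>m\<in>Poly_Mapping.keys F. Poly_Mapping.single m (Poly_Mapping.lookup F m))"
  by (rule poly_mapping_eqI)
     (auto simp: lookup_sum lookup_single when_def in_keys_iff sum.delta)

lemma mpoly_term_induct [case_names add single]:
  fixes F :: "_ \<Rightarrow>\<^sub>0 _::comm_monoid_add"
  assumes "\<And>F G. P F \<Longrightarrow> P G \<Longrightarrow> P (F + G)" "\<And>m c. P (Poly_Mapping.single m c)"
  shows "P F"
proof -
  have z: "P 0" using assms(2)[of undefined 0] by simp
  have "P (\<Sum>m\<in>S. Poly_Mapping.single m (Poly_Mapping.lookup F m))" if "finite S" for S
    using that by (induction S) (auto intro: z assms)
  from this[of "Poly_Mapping.keys F"] show ?thesis by (simp flip: sum_of_terms)
qed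

lemma mpeval_term:
  assumes "h 0 = 0"
  shows "mpeval h p (Poly_Mapping.single m c) = h c * mon_eval p m"
  by (subst mpeval_superset[of _ "{m}"]) (use assms in auto)

lemma mpeval_0 [simp]: "mpeval h p 0 = 0"
  by (simp add: mpeval_def)

context comm_ring_hom
begin

lemma mpeval_add: "mpeval hom p (F + G) = mpeval hom p F + mpeval hom p G"
proof -
  let ?S = "Poly_Mapping.keys F \<union> Poly_Mapping.keys G"
  have "Poly_Mapping.keys (F + G) \<subseteq> ?S" by (rule keys_add)
  then show ?thesis
    by (simp add: mpeval_superset[of _ ?S] lookup_add hom_add distrib_right sum.distrib)
qed

lemma mpeval_mult: "mpeval hom p (F * G) = mpeval hom p F * mpeval hom p G"
proof (induction F rule: mpoly_term_induct)
  case (add F F')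
  then show ?case by (simp add: distrib_right mpeval_add)
next
  case (single m c)
  show ?case
    by (induction G rule: mpoly_term_induct)
       (simp_all add: distrib_left distrib_right mpeval_add mult_single mpeval_term mon_eval_add hom_mult ac_simps)
qed

lemma mpeval_Cst [simp]: "mpeval hom p (Cst c) = hom c"
  by (simp add: Cst_def mpeval_term)

lemma mpeval_Var [simp]: "mpeval hom p (Var v) = p v"
  by (simp add: Var_def mpeval_term)

lemma comm_ring_hom_mpeval: "comm_ring_hom (mpeval hom p)"
proof
  have "mpeval hom p (Cst 1) = 1" by simp
  then show "mpeval hom p 1 = 1" by (simp add: Cst_def)
qed (simp_all add: mpeval_add mpeval_mult)

text \<open>This one statement covers evaluation after substitution, change of the coefficient field, and
  restriction of a polynomial to a line.\<close>

lemma hom_mpeval: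
  "hom (mpeval h p F) = mpeval (\<lambda>c. hom (h c)) (\<lambda>v. hom (p v)) F"
  unfolding mpeval_def by (simp add: hom_sum hom_mult hom_prod hom_power)

end

lemma comm_ring_hom_Cst: "comm_ring_hom (Cst :: 'k::comm_ring_1 \<Rightarrow> ('v, 'k) mpoly)"
  by standard (simp_all add: Cst_def single_add mult_single)

lemma comm_ring_hom_to_ac: "comm_ring_hom (to_ac :: 'k::field \<Rightarrow> 'k alg_closure)"
  by standard simp_all

lemma comm_ring_hom_ident: "comm_ring_hom (\<lambda>a::'k::comm_ring_1. a)"
  by standard simp_all

interpretation Cst: comm_ring_hom "Cst :: 'k::comm_ring_1 \<Rightarrow> ('v, 'k) mpoly"
  by (rule comm_ring_hom_Cst)

interpretation subst: comm_ring_hom "mpeval Cst \<sigma> :: ('v, 'k::comm_ring_1) mpoly \<Rightarrow> ('w, 'k) mpoly" for \<sigma>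
  by (rule Cst.comm_ring_hom_mpeval)

interpretation to_ac: comm_ring_hom "to_ac :: 'k::field \<Rightarrow> 'k alg_closure"
  by (rule comm_ring_hom_to_ac)

interpretation ev_ac: comm_ring_hom "mpeval to_ac p :: ('v, 'k::field) mpoly \<Rightarrow> 'k alg_closure" for p
  by (rule to_ac.comm_ring_hom_mpeval)

lemmas ev_Cst [simp] = comm_ring_hom.mpeval_Cst[OF comm_ring_hom_ident]
lemmas ev_Var [simp] = comm_ring_hom.mpeval_Var[OF comm_ring_hom_ident]

interpretation ev: comm_ring_hom "mpeval (\<lambda>a. a) p :: ('v, 'k::comm_ring_1) mpoly \<Rightarrow> 'k" for p
  by (rule comm_ring_hom.comm_ring_hom_mpeval[OF comm_ring_hom_ident])

lemma mpeval_Cst_Var: "mpeval Cst Var F = (F :: ('v, 'k::comm_ring_1) mpoly)"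
proof (induction F rule: mpoly_term_induct)
  case (single m c)
  have 1: "Var v ^ k = (Poly_Mapping.single (Poly_Mapping.single v k) 1 :: ('v,'k) mpoly)" for v k
    by (induction k) (simp_all add: Var_def mult_single single_add[symmetric])
  have "mon_eval Var m = (Poly_Mapping.single m 1 :: ('v,'k) mpoly)"
  proof -
    have "(\<Prod>v\<in>S. Poly_Mapping.single (Poly_Mapping.single v (g v)) (1::'k)) =
        Poly_Mapping.single (\<Sum>v\<in>S. Poly_Mapping.single v (g v)) 1" if "finite S" for S :: "'v set" and g :: "'v \<Rightarrow> nat"
      using that by (induction S) (simp_all add: mult_single)
    then show ?thesis
      unfolding mon_eval_def 1 by (simp flip: sum_of_terms)
  qed
  then show ?case by (simp add: mpeval_term Cst_def mult_single)
qed (simp add: Cst.mpeval_add)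

section \<open>Subrings of polynomials and forms\<close>

lemma polys_Cst [simp]: "Cst c \<in> polys n"
  by (auto simp: polys_def Cst_def)

lemma polys_0 [simp]: "0 \<in> polys n" and polys_1 [simp]: "1 \<in> polys n"
  by (auto simp: polys_def)

lemma polys_Var [simp]: "v \<le> n \<Longrightarrow> (Var v :: (nat,'k::zero_neq_one) mpoly) \<in> polys n"
  by (auto simp: polys_def Var_def)

lemma polys_add: "F \<in> polys n \<Longrightarrow> G \<in> polys n \<Longrightarrow> (F + G) \<in> polys n"
  using keys_add[of F G] unfolding polys_def by blast

lemma polys_uminus: "(F::(nat,'k::comm_ring_1) mpoly) \<in> polys n \<Longrightarrow> - F \<in> polys n"
  unfolding polys_def by simp

lemma polys_mult: "F \<in> polys n \<Longrightarrow> G \<in> polys n \<Longrightarrow> (F * G) \<in> polys n"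
  unfolding polys_def
proof (intro CollectI ballI)
  assume FG: "F \<in> {F. \<forall>m\<in>Poly_Mapping.keys F. Poly_Mapping.keys m \<subseteq> {..n}}"
    "G \<in> {F. \<forall>m\<in>Poly_Mapping.keys F. Poly_Mapping.keys m \<subseteq> {..n}}"
  fix m assume "m \<in> Poly_Mapping.keys (F * G)"
  then obtain a b where "a \<in> Poly_Mapping.keys F" "b \<in> Poly_Mapping.keys G" "m = a + b"
    using keys_mult[of F G] by blast
  then show "Poly_Mapping.keys m \<subseteq> {..n}"
    using FG keys_add[of a b] by blast
qed

lemma polys_sum: "(\<And>x. x \<in> S \<Longrightarrow> f x \<in> polys n) \<Longrightarrow> sum f S \<in> polys n"
  by (induction S rule: infinite_finite_induct) (auto intro: polys_add)

lemma polys_induct [consumes 1, case_names Cst Var add mult]: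
  fixes F :: "(nat, 'k::comm_ring_1) mpoly"
  assumes "F \<in> polys n"
    and C: "\<And>c. P (Cst c)" and V: "\<And>v. v \<le> n \<Longrightarrow> P (Var v)"
    and A: "\<And>F G. F \<in> polys n \<Longrightarrow> G \<in> polys n \<Longrightarrow> P F \<Longrightarrow> P G \<Longrightarrow> P (F + G)"
    and M: "\<And>F G. F \<in> polys n \<Longrightarrow> G \<in> polys n \<Longrightarrow> P F \<Longrightarrow> P G \<Longrightarrow> P (F * G)"
  shows "P F"
proof -
  define R where "R = {F \<in> polys n. P F}"
  have C': "Cst c \<in> R" for c using C by (simp add: R_def)
  have 0: "0 \<in> R" using C'[of 0] by simp
  have 1: "1 \<in> R" using C'[of 1] by simp
  have A': "F + G \<in> R" if "F \<in> R" "G \<in> R" for F G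
    using that A polys_add unfolding R_def by blast
  have M': "F * G \<in> R" if "F \<in> R" "G \<in> R" for F G
    using that M polys_mult unfolding R_def by blast
  have S': "sum f S \<in> R" if "\<And>x. x \<in> S \<Longrightarrow> f x \<in> R" for S :: "(nat \<Rightarrow>\<^sub>0 nat) set" and f
    using that by (induction S rule: infinite_finite_induct) (auto intro: A' 0)
  have P': "prod f S \<in> R" if "\<And>x. x \<in> S \<Longrightarrow> f x \<in> R" for S :: "nat set" and f
    using that by (induction S rule: infinite_finite_induct) (auto intro: M' 1)
  have pw: "x ^ k \<in> R" if "x \<in> R" for x and k :: nat
    using that by (induction k) (auto intro: M' 1)
  have V': "Var v \<in> R" if "v \<le> n" for v
    using V that by (simp add: R_def)
  have "mpeval Cst Var F \<in> R"
    unfolding mpeval_def using assms(1)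
    by (intro S' M' C' P' pw V') (auto simp: polys_def)
  then show ?thesis by (simp add: mpeval_Cst_Var R_def)
qed

lemma mpeval_cong:
  assumes "F \<in> polys n" "\<And>v. v \<le> n \<Longrightarrow> p v = q v"
  shows "mpeval h p F = mpeval h q F"
  unfolding mpeval_def
  by (intro sum.cong arg_cong2[of _ _ _ _ "(*)"] prod.cong refl arg_cong2[of _ _ _ _ "(^)"])
     (use assms in \<open>auto simp: polys_def\<close>)

definition mdeg :: "(nat \<Rightarrow>\<^sub>0 nat) \<Rightarrow> nat" where
  "mdeg m = (\<Sum>v\<in>Poly_Mapping.keys m. Poly_Mapping.lookup m v)"

lemma mdeg_superset:
  "finite S \<Longrightarrow> Poly_Mapping.keys m \<subseteq> S \<Longrightarrow> mdeg m = (\<Sum>v\<in>S. Poly_Mapping.lookup m v)"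
  unfolding mdeg_def by (rule sum.mono_neutral_left) (auto simp: in_keys_iff)

lemma mdeg_add: "mdeg (m + m') = mdeg m + mdeg m'"
proof -
  let ?S = "Poly_Mapping.keys m \<union> Poly_Mapping.keys m'"
  have "Poly_Mapping.keys (m + m') \<subseteq> ?S" by (rule keys_add)
  then show ?thesis by (simp add: mdeg_superset[of ?S] lookup_add sum.distrib)
qed

lemma mdeg_single [simp]: "mdeg (Poly_Mapping.single v k) = k"
  by (simp add: mdeg_superset[of "{v}"])

lemma mdeg_0 [simp]: "mdeg 0 = 0"
  by (simp add: mdeg_def)

lemma forms_iff: "F \<in> forms n d \<longleftrightarrow> F \<in> polys n \<and> (\<forall>m\<in>Poly_Mapping.keys F. mdeg m = d)"
  by (simp add: forms_def mdeg_def)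

lemma forms_0 [simp]: "0 \<in> forms n d"
  by (simp add: forms_iff)

lemma forms_Cst [simp]: "Cst c \<in> forms n 0"
  by (auto simp: forms_iff) (auto simp: Cst_def split: if_splits)

lemma forms_Var [simp]: "v \<le> n \<Longrightarrow> (Var v :: (nat,'k::zero_neq_one) mpoly) \<in> forms n (Suc 0)"
  by (auto simp: forms_iff) (auto simp: Var_def)

lemma forms_add: "F \<in> forms n d \<Longrightarrow> G \<in> forms n d \<Longrightarrow> (F + G) \<in> forms n d"
  using keys_add[of F G] unfolding forms_iff by (blast intro: polys_add)

lemma forms_uminus: "(F::(nat,'k::comm_ring_1) mpoly) \<in> forms n d \<Longrightarrow> - F \<in> forms n d"
  by (simp add: forms_iff polys_uminus)

lemma forms_mult: "F \<in> forms n d \<Longrightarrow> G \<in> forms n e \<Longrightarrow> (F * G) \<in> forms n (d + e)"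
  unfolding forms_iff using keys_mult[of F G] by (auto simp: mdeg_add intro: polys_mult)

lemma forms_Cst_mult: "G \<in> forms n e \<Longrightarrow> (Cst c * G) \<in> forms n e"
  using forms_mult[OF forms_Cst, of G n e c] by simp

lemma forms_sum: "(\<And>x. x \<in> S \<Longrightarrow> f x \<in> forms n d) \<Longrightarrow> sum f S \<in> forms n d"
  by (induction S rule: infinite_finite_induct) (auto intro: forms_add)

lemma forms_prod:
  "finite S \<Longrightarrow> (\<And>x. x \<in> S \<Longrightarrow> (f x :: (nat,'k::comm_ring_1) mpoly) \<in> forms n (Suc 0)) \<Longrightarrow> prod f S \<in> forms n (card S)"
proof (induction S rule: finite_induct)
  case empty
  then show ?case using forms_Cst[of "1::'k" n] by simp
next
  case (insert x S)
  then show ?case using forms_mult[of "f x" n "Suc 0" "prod f S" "card S"] by simp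
qed

lemma lookup_Var_mult:
  fixes Q :: "('v, 'k::comm_ring_1) mpoly"
  shows "Poly_Mapping.lookup (Var i * Q) (Poly_Mapping.single i 1 + m) = Poly_Mapping.lookup Q m"
proof (induction Q rule: mpoly_term_induct)
  case (single m' c)
  have "Poly_Mapping.single i 1 + m' = Poly_Mapping.single i 1 + m \<longleftrightarrow> m' = m"
    by (rule add_left_cancel)
  then show ?case
    unfolding Var_def mult_single mult_1 lookup_single by presburger
next
  case (add F G)
  then show ?case unfolding distrib_left lookup_add by presburger
qed

lemma forms_cancel_Var:
  fixes Q :: "(nat, 'k::comm_ring_1) mpoly"
  assumes "Var i * Q \<in> forms n d"
  shows "Q \<in> forms n (d - 1)"
proof -
  have "Poly_Mapping.keys m \<subseteq> {..n} \<and> mdeg m = d - 1" if "m \<in> Poly_Mapping.keys Q" for m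
  proof -
    have *: "Poly_Mapping.single i 1 + m \<in> Poly_Mapping.keys (Var i * Q)"
      using that unfolding in_keys_iff lookup_Var_mult .
    have "Poly_Mapping.keys (Poly_Mapping.single i 1 + m) \<subseteq> {..n}" "mdeg (Poly_Mapping.single i 1 + m) = d"
      using assms * by (auto simp only: forms_iff polys_def mem_Collect_eq)
    moreover have "Poly_Mapping.keys m \<subseteq> Poly_Mapping.keys (Poly_Mapping.single i 1 + m)"
      by (auto simp: in_keys_iff lookup_add)
    ultimately show ?thesis by (auto simp: mdeg_add)
  qed
  then show ?thesis by (auto simp: forms_iff polys_def)
qed

lemma Var_neq_0 [simp]: "(Var v :: ('v, 'k::comm_ring_1) mpoly) \<noteq> 0"
  by (simp add: Var_def single_zero flip: keys_eq_empty)

section \<open>Cofactors of singular matrices\<close>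

definition subst_row :: "'a::comm_ring_1 mat \<Rightarrow> nat \<Rightarrow> (nat \<Rightarrow> 'a) \<Rightarrow> 'a mat" where
  "subst_row M i v = mat (dim_row M) (dim_col M) (\<lambda>(r, c). if r = i then v c else M $$ (r, c))"

lemma det_subst_row:
  assumes "M \<in> carrier_mat N N" "i < N"
  shows "det (subst_row M i v) = (\<Sum>j<N. v j * cofactor M i j)"
proof -
  have "mat_delete (subst_row M i v) i j = mat_delete M i j" for j
    by (rule eq_matI) (use assms in \<open>auto simp: mat_delete_def subst_row_def\<close>)
  then have "cofactor (subst_row M i v) i j = cofactor M i j" for j
    by (simp add: cofactor_def)
  moreover have "subst_row M i v \<in> carrier_mat N N"
    using assms by (simp add: subst_row_def)
  ultimately show ?thesis
    using assms by (subst laplace_expansion_row[of _ N i]) (auto simp: subst_row_def intro!: sum.cong)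
qed

lemma cofactor_as_det:
  assumes "M \<in> carrier_mat N N" "i < N" "k < N"
  shows "cofactor M i k = det (subst_row M i (\<lambda>c. if c = k then 1 else 0))"
  using assms by (simp add: det_subst_row if_distrib[of "\<lambda>x. x * _"] cong: if_cong)

lemma det_eq_0_if_kernel:
  fixes M :: "'a::idom mat"
  assumes M: "M \<in> carrier_mat N N" and ker: "\<And>r. r < N \<Longrightarrow> (\<Sum>c<N. M $$ (r, c) * v c) = 0"
    and v: "c < N" "v c \<noteq> 0"
  shows "det M = 0"
  unfolding det_0_iff_vec_prod_zero[OF M]
proof (intro exI conjI)
  show "vec N v \<in> carrier_vec N" by simp
  show "vec N v \<noteq> 0\<^sub>v N" using v by (auto simp: vec_eq_iff)
  show "M *\<^sub>v vec N v = 0\<^sub>v N"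
    using M ker by (auto simp: vec_eq_iff scalar_prod_def atLeast0LessThan)
qed

text \<open>If \<open>M v = 0\<close>, every row of cofactors of \<open>M\<close> is proportional to \<open>v\<close>. Replacing row \<open>i\<close> by
  the vector \<open>v\<^sub>j e\<^sub>k - v\<^sub>k e\<^sub>j\<close>, which is orthogonal to \<open>v\<close>, keeps \<open>v\<close> in the kernel, and the
  expansion of the resulting vanishing determinant along that row is the asserted relation.\<close>

lemma cofactor_kernel:
  fixes M :: "'a::idom mat"
  assumes M: "M \<in> carrier_mat N N" and ker: "\<And>r. r < N \<Longrightarrow> (\<Sum>c<N. M $$ (r, c) * v c) = 0"
    and ijk: "i < N" "j < N" "k < N"
  shows "v j * cofactor M i k = v k * cofactor M i j"
proof (cases "j = k \<or> (\<forall>c<N. v c = 0)")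
  case True
  then show ?thesis using ijk by auto
next
  case False
  then obtain c where c: "c < N" "v c \<noteq> 0" by blast
  define row where "row = (\<lambda>c. (if c = k then v j else 0) - (if c = j then v k else 0))"
  have row: "(\<Sum>c<N. row c * z c) = v j * z k - v k * z j" for z
    using ijk by (simp add: row_def left_diff_distrib sum_subtractf if_distrib[of "\<lambda>x. x * _"] cong: if_cong)
  have "det (subst_row M i row) = 0"
  proof (rule det_eq_0_if_kernel[where v = v, OF _ _ c])
    show "subst_row M i row \<in> carrier_mat N N" using M by (simp add: subst_row_def)
    fix r assume "r < N"
    then show "(\<Sum>c<N. subst_row M i row $$ (r, c) * v c) = 0"
      using M ker[of r] row[of v] by (cases "r = i") (simp_all add: subst_row_def)
  qed
  then show ?thesis
    using row[of "cofactor M i"] by (simp add: det_subst_row[OF M ijk(1)])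
qed

lemma cofactor_transpose:
  assumes "M \<in> carrier_mat N N" "i < N" "j < N"
  shows "cofactor (transpose_mat M) i j = cofactor M j i"
proof -
  have "mat_delete (transpose_mat M) i j = transpose_mat (mat_delete M j i)"
    by (rule eq_matI) (use assms in \<open>auto simp: mat_delete_def\<close>)
  moreover have "mat_delete M j i \<in> carrier_mat (N - 1) (N - 1)"
    using assms(1) by (rule mat_delete_carrier)
  ultimately show ?thesis
    by (simp add: cofactor_def det_transpose add.commute)
qed

lemma cofactor_left_kernel:
  fixes M :: "'a::idom mat"
  assumes M: "M \<in> carrier_mat N N" and ker: "\<And>c. c < N \<Longrightarrow> (\<Sum>r<N. v r * M $$ (r, c)) = 0"
    and ijk: "i < N" "j < N" "k < N"
  shows "v j * cofactor M k i = v k * cofactor M j i"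
proof -
  have "v j * cofactor (transpose_mat M) i k = v k * cofactor (transpose_mat M) i j"
    using M ker ijk by (intro cofactor_kernel[of _ N]) (auto simp: mult.commute)
  then show ?thesis using M ijk by (simp add: cofactor_transpose)
qed

text \<open>The hypothesis says \<open>A = D\<inverse> B\<^sup>T D\<close> with \<open>D\<close> diagonal; multiplied through by \<open>D\<close> it makes sense
  over an integral domain such as a polynomial ring.\<close>

lemma det_eq_if_diagonally_conjugate:
  fixes A B :: "'a::idom mat"
  assumes A: "A \<in> carrier_mat N N" and B: "B \<in> carrier_mat N N"
    and conj: "\<And>i j. i < N \<Longrightarrow> j < N \<Longrightarrow> d i * A $$ (i, j) = B $$ (j, i) * d j"
    and d: "\<And>i. i < N \<Longrightarrow> d i \<noteq> 0"
  shows "det A = det B"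
proof -
  let ?I = "{0..<N}"
  have "(\<Prod>i\<in>?I. d i) * det A = (\<Prod>i\<in>?I. d i) * det (transpose_mat B)"
    unfolding det_def'[OF A] det_def'[OF transpose_carrier_mat[THEN iffD2, OF B]] sum_distrib_left
  proof (intro sum.cong refl)
    fix p assume "p \<in> {p. p permutes ?I}"
    then have p: "p permutes ?I" by simp
    have "(\<Prod>i\<in>?I. d i) * (\<Prod>i\<in>?I. A $$ (i, p i)) = (\<Prod>i\<in>?I. d i * A $$ (i, p i))"
      by (simp add: prod.distrib)
    also have "\<dots> = (\<Prod>i\<in>?I. B $$ (p i, i) * d (p i))"
      using permutes_in_image[OF p] by (intro prod.cong) (auto intro!: conj)
    also have "\<dots> = (\<Prod>i\<in>?I. transpose_mat B $$ (i, p i)) * (\<Prod>i\<in>?I. d (p i))"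
      using permutes_in_image[OF p] B by (simp add: prod.distrib)
    also have "(\<Prod>i\<in>?I. d (p i)) = (\<Prod>i\<in>?I. d i)"
      using prod.permute[OF p, of d] by (simp add: comp_def)
    finally show "(\<Prod>i\<in>?I. d i) * (signof p * (\<Prod>i\<in>?I. A $$ (i, p i))) =
        (\<Prod>i\<in>?I. d i) * (signof p * (\<Prod>i\<in>?I. transpose_mat B $$ (i, p i)))"
      by (simp add: mult_ac)
  qed
  moreover have "(\<Prod>i\<in>?I. d i) \<noteq> 0" using d by simp
  ultimately show ?thesis using det_transpose[OF B] by simp
qed

section \<open>Principal minors of weighted Laplacians\<close>

text \<open>Minus the Laplacian of the complete directed graph on \<open>{..n}\<close> whose edge from \<open>i\<close> to \<open>j\<close> has weight
  \<open>A\<^sub>i\<^sub>j x\<^sub>j\<close>. The ring is arbitrary, so that the same matrix serves for polynomials, for their values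
  and for the result of a substitution.\<close>

definition lap :: "nat \<Rightarrow> (nat \<Rightarrow> nat \<Rightarrow> 'a) \<Rightarrow> (nat \<Rightarrow> 'a) \<Rightarrow> 'a::comm_ring_1 mat" where
  "lap n A x = mat (n + 1) (n + 1)
     (\<lambda>(i, j). if i = j then - (\<Sum>k\<in>{..n} - {i}. A i k * x k) else A i j * x j)"

definition lap_minor :: "nat \<Rightarrow> (nat \<Rightarrow> nat \<Rightarrow> 'a) \<Rightarrow> (nat \<Rightarrow> 'a) \<Rightarrow> nat \<Rightarrow> 'a::comm_ring_1" where
  "lap_minor n A x i = det (mat_delete (lap n A x) i i)"

lemma lap_carrier [simp]: "lap n A x \<in> carrier_mat (n + 1) (n + 1)"
  by (simp add: lap_def)

lemma lap_dim [simp]: "dim_row (lap n A x) = n + 1" "dim_col (lap n A x) = n + 1"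
  by (simp_all add: lap_def)

lemma lap_index:
  "i \<le> n \<Longrightarrow> j \<le> n \<Longrightarrow> lap n A x $$ (i, j) =
     (if i = j then - (\<Sum>k\<in>{..n} - {i}. A i k * x k) else A i j * x j)"
  by (simp add: lap_def)

lemma lessThan_Suc_split:
  fixes f :: "nat \<Rightarrow> 'a::comm_monoid_add"
  assumes "i \<le> n"
  shows "(\<Sum>j<n + 1. f j) = f i + (\<Sum>j\<in>{..n} - {i}. f j)"
proof -
  have "{..<n + 1} = {..n}" by auto
  then show ?thesis using sum.remove[of "{..n}" i f] assms by simp
qed

lemma lap_row_sum: "i \<le> n \<Longrightarrow> (\<Sum>j<n + 1. lap n A x $$ (i, j) * 1) = 0"
  by (subst lessThan_Suc_split[of i]) (auto simp: lap_index intro!: sum.cong)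

text \<open>The rows of the matrix sum to zero, hence all its cofactors along a row coincide.\<close>

lemma lap_minor_eq_cofactor:
  fixes A :: "nat \<Rightarrow> nat \<Rightarrow> 'a::idom"
  assumes "i \<le> n" "k \<le> n"
  shows "lap_minor n A x i = cofactor (lap n A x) i k"
proof -
  have "1 * cofactor (lap n A x) i i = 1 * cofactor (lap n A x) i k"
    by (rule cofactor_kernel[of _ "n + 1" "\<lambda>_. 1"]) (use assms lap_row_sum[of _ n A x] in auto)
  then show ?thesis by (simp add: lap_minor_def cofactor_def)
qed

lemma lap_minor_cong:
  assumes "\<And>j. j \<le> n \<Longrightarrow> x j = y j"
  shows "lap_minor n A x i = lap_minor n A y i"
proof -
  have "lap n A x = lap n A y"
    by (rule eq_matI) (use assms in \<open>auto simp: lap_def intro!: sum.cong\<close>)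
  then show ?thesis by (simp add: lap_minor_def)
qed

text \<open>Since all cofactors in a row agree, the expansion of \<open>det B = 0\<close> along column \<open>j\<close> only involves the
  principal minors. The scalars \<open>b\<^sub>j\<^sub>,\<^sub>i\<close> are read off from the resulting relation.\<close>

lemma lap_minor_balance:
  fixes A :: "nat \<Rightarrow> nat \<Rightarrow> 'a::idom"
  assumes j: "j \<le> n"
  shows "lap_minor n A x j * (\<Sum>k\<in>{..n} - {j}. A j k * x k)
       = x j * (\<Sum>i\<in>{..n} - {j}. A i j * lap_minor n A x i)"
proof -
  have "0 = det (lap n A x)"
    using lap_row_sum[of _ n A x]
    by (subst det_eq_0_if_kernel[of _ "n + 1" "\<lambda>_. 1" 0]) auto
  also have "\<dots> = (\<Sum>i<n + 1. lap n A x $$ (i, j) * lap_minor n A x i)"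
    using j by (subst laplace_expansion_column[of _ "n + 1" j])
      (auto intro!: sum.cong simp: lap_minor_eq_cofactor[of _ _ j])
  also have "\<dots> = - (lap_minor n A x j * (\<Sum>k\<in>{..n} - {j}. A j k * x k))
       + x j * (\<Sum>i\<in>{..n} - {j}. A i j * lap_minor n A x i)"
    using j by (subst lessThan_Suc_split[of j])
      (auto simp: lap_index sum_distrib_left mult_ac intro!: sum.cong)
  finally show ?thesis by simp
qed

text \<open>Conversely these relations determine \<open>(det B\<^sub>0 : \<dots> : det B\<^sub>n)\<close>, because they say that \<open>y\<close> is in
  the left kernel of \<open>B\<close>.\<close>

lemma lap_minor_unique:
  fixes A :: "nat \<Rightarrow> nat \<Rightarrow> 'a::idom"
  assumes bal: "\<And>j. j \<le> n \<Longrightarrow> y j * (\<Sum>k\<in>{..n} - {j}. A j k * x k)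
       = x j * (\<Sum>i\<in>{..n} - {j}. A i j * y i)"
    and ij: "i \<le> n" "j \<le> n"
  shows "y i * lap_minor n A x j = y j * lap_minor n A x i"
proof -
  have "(\<Sum>r<n + 1. y r * lap n A x $$ (r, c)) = 0" if "c < n + 1" for c
  proof -
    have "(\<Sum>r<n + 1. y r * lap n A x $$ (r, c)) =
      - (y c * (\<Sum>k\<in>{..n} - {c}. A c k * x k)) + x c * (\<Sum>i\<in>{..n} - {c}. A i c * y i)"
      using that by (subst lessThan_Suc_split[of c])
        (auto simp: lap_index sum_distrib_left mult_ac intro!: sum.cong)
    then show ?thesis using bal[of c] that by simp
  qed
  from cofactor_left_kernel[OF lap_carrier this, of i i j]
  show ?thesis using ij by (simp add: lap_minor_eq_cofactor[of _ _ i])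
qed

lemma (in comm_ring_hom) hom_lap_minor:
  assumes "i \<le> n"
  shows "hom (lap_minor n A x i) = lap_minor n (\<lambda>i j. hom (A i j)) (\<lambda>j. hom (x j)) i"
proof -
  have "map_mat hom (mat_delete (lap n A x) i i) =
      mat_delete (lap n (\<lambda>i j. hom (A i j)) (\<lambda>j. hom (x j))) i i"
    by (rule eq_matI) (auto simp: mat_delete_def lap_def hom_sum hom_mult hom_uminus)
  then show ?thesis by (simp add: lap_minor_def flip: hom_det)
qed

text \<open>All cofactors in a row agree, so column \<open>i\<close> may be kept and another one deleted instead; the
  entries of column \<open>i\<close> off the diagonal are multiples of \<open>x\<^sub>i\<close>.\<close>

lemma coordinate_dvd_lap_minor:
  fixes A :: "nat \<Rightarrow> nat \<Rightarrow> 'a::idom"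
  assumes "n \<ge> 1" "i \<le> n"
  shows "x i dvd lap_minor n A x i"
proof -
  obtain k where k: "k \<le> n" "k \<noteq> i" using assms by (metis One_nat_def le0 not_one_le_zero)
  let ?N = "subst_row (lap n A x) i (\<lambda>c. if c = k then 1 else 0)"
  have N: "?N \<in> carrier_mat (n + 1) (n + 1)" by (simp add: subst_row_def)
  have "lap_minor n A x i = det ?N"
    using assms k by (subst lap_minor_eq_cofactor[of _ _ k]) (auto simp: cofactor_as_det[OF lap_carrier])
  also have "\<dots> = (\<Sum>r<n + 1. ?N $$ (r, i) * cofactor ?N r i)"
    using assms by (intro laplace_expansion_column[OF N]) auto
  also have "x i dvd \<dots>"
  proof (rule dvd_sum)
    fix r assume "r \<in> {..<n + 1}"
    then have "?N $$ (r, i) = (if r = i then 0 else A r i * x i)"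
      using assms k by (auto simp: subst_row_def lap_index)
    then show "x i dvd ?N $$ (r, i) * cofactor ?N r i" by simp
  qed
  finally show ?thesis .
qed

lemma lap_minor_as_det:
  fixes A :: "nat \<Rightarrow> nat \<Rightarrow> 'a::idom"
  assumes "i \<le> n"
  shows "lap_minor n A x i = det (subst_row (lap n A x) i (\<lambda>c. if c = i then 1 else 0))"
  using assms by (subst lap_minor_eq_cofactor[of _ _ i]) (auto simp: cofactor_as_det[OF lap_carrier])

text \<open>The hypotheses say that column \<open>k\<close> of the matrix is zero.\<close>

lemma lap_minor_zero_column:
  fixes A :: "nat \<Rightarrow> nat \<Rightarrow> 'a::idom"
  assumes ik: "i \<le> n" "k \<le> n" "k \<noteq> i"
    and zero: "x k = 0" "(\<Sum>j\<in>{..n} - {k}. A k j * x j) = 0"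
  shows "lap_minor n A x i = 0"
proof -
  let ?N = "subst_row (lap n A x) i (\<lambda>c. if c = i then 1 else 0)"
  have "?N \<in> carrier_mat (n + 1) (n + 1)" by (simp add: subst_row_def)
  then have "det ?N = (\<Sum>r<n + 1. ?N $$ (r, k) * cofactor ?N r k)"
    using ik by (intro laplace_expansion_column) auto
  also have "\<dots> = 0"
    using ik zero by (intro sum.neutral) (auto simp: subst_row_def lap_def)
  finally show ?thesis using ik by (simp add: lap_minor_as_det)
qed

text \<open>At the \<open>k\<close>-th coordinate point row \<open>k\<close> of the matrix is zero.\<close>

lemma lap_minor_unit_vector_0:
  fixes A :: "nat \<Rightarrow> nat \<Rightarrow> 'a::idom"
  assumes ik: "i \<le> n" "k \<le> n" "k \<noteq> i" and x: "\<And>j. j \<le> n \<Longrightarrow> j \<noteq> k \<Longrightarrow> x j = 0"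
  shows "lap_minor n A x i = 0"
proof -
  let ?N = "subst_row (lap n A x) i (\<lambda>c. if c = i then 1 else 0)"
  have "?N \<in> carrier_mat (n + 1) (n + 1)" by (simp add: subst_row_def)
  then have "det ?N = (\<Sum>c<n + 1. ?N $$ (k, c) * cofactor ?N k c)"
    using ik by (intro laplace_expansion_row) auto
  also have "\<dots> = 0"
    using ik x by (intro sum.neutral) (auto simp: subst_row_def lap_def)
  finally show ?thesis using ik by (simp add: lap_minor_as_det)
qed

text \<open>At the \<open>i\<close>-th coordinate point the submatrix \<open>B\<^sub>i\<close> is diagonal with entries \<open>- a\<^sub>r\<^sub>i x\<^sub>i\<close>.\<close>

lemma lap_minor_unit_vector:
  fixes A :: "nat \<Rightarrow> nat \<Rightarrow> 'a::idom"
  assumes i: "i \<le> n" and x: "x i \<noteq> 0" "\<And>j. j \<le> n \<Longrightarrow> j \<noteq> i \<Longrightarrow> x j = 0"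
    and A: "\<And>r. r \<le> n \<Longrightarrow> r \<noteq> i \<Longrightarrow> A r i \<noteq> 0"
  shows "lap_minor n A x i \<noteq> 0"
proof
  let ?N = "subst_row (lap n A x) i (\<lambda>c. if c = i then 1 else 0)"
  have N: "?N \<in> carrier_mat (n + 1) (n + 1)" by (simp add: subst_row_def)
  assume "lap_minor n A x i = 0"
  then have "det ?N = 0" using i by (simp add: lap_minor_as_det)
  then obtain v where v: "v \<in> carrier_vec (n + 1)" "v \<noteq> 0\<^sub>v (n + 1)" "?N *\<^sub>v v = 0\<^sub>v (n + 1)"
    unfolding det_0_iff_vec_prod_zero[OF N] by blast
  have ker: "(\<Sum>c<n + 1. ?N $$ (r, c) * v $ c) = 0" if "r \<le> n" for r
    using arg_cong[OF v(3), of "\<lambda>w. vec_index w r"] N v(1) that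
    by (simp add: scalar_prod_def atLeast0LessThan)
  have vi: "v $ i = 0"
    using ker[OF i] i by (subst (asm) lessThan_Suc_split[of i]) (auto simp: subst_row_def)
  have "v $ r = 0" if r: "r \<le> n" "r \<noteq> i" for r
  proof -
    have f: "(\<Sum>k\<in>{..n} - {r}. A r k * x k) = A r i * x i"
      using r i x by (subst sum.remove[of _ i]) (auto intro!: sum.neutral)
    have xv: "x k = 0 \<or> v $ k = 0" if "k \<le> n" for k
      using that x vi by (cases "k = i") auto
    have "(\<Sum>c<n + 1. ?N $$ (r, c) * v $ c) = - (A r i * x i) * v $ r"
      using r i by (subst lessThan_Suc_split[of r])
        (use xv in \<open>auto simp: subst_row_def lap_index f intro!: sum.neutral\<close>)
    then show ?thesis using ker[OF r(1)] A[OF r] x by simp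
  qed
  with vi have "v = 0\<^sub>v (n + 1)" using v(1) by (auto simp: vec_eq_iff) (metis less_Suc_eq_le)
  with v(2) show False by simp
qed

text \<open>The matrix \<open>C\<close> is \<open>D\<inverse> L\<^sup>T D\<close> with \<open>D = diag(y\<^sub>0,\<dots>,y\<^sub>n)\<close> and \<open>L\<close> the
  matrix \<open>lap\<close> of the transposed weights.\<close>

lemma lap_minor_transposed_weights:
  fixes A :: "nat \<Rightarrow> nat \<Rightarrow> 'a::idom"
  assumes y: "\<And>j. j \<le> n \<Longrightarrow> y j \<noteq> 0" and i: "i \<le> n"
    and C: "C = mat (n + 1) (n + 1)
      (\<lambda>(i, j). if i = j then - (\<Sum>k\<in>{..n} - {i}. A k i * y k) else A i j * y j)"
  shows "det (mat_delete C i i) = lap_minor n (\<lambda>i j. A j i) y i"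
  unfolding lap_minor_def
proof (rule det_eq_if_diagonally_conjugate)
  let ?d = "\<lambda>r. y (if r < i then r else Suc r)"
  show "mat_delete C i i \<in> carrier_mat n n" using mat_delete_carrier[of C "n + 1" "n + 1" i i] C by simp
  show "mat_delete (lap n (\<lambda>i j. A j i) y) i i \<in> carrier_mat n n"
    using mat_delete_carrier[OF lap_carrier] by simp
  show "?d r \<noteq> 0" if "r < n" for r using y that by auto
  show "?d r * mat_delete C i i $$ (r, c) = mat_delete (lap n (\<lambda>i j. A j i) y) i i $$ (c, r) * ?d c"
    if "r < n" "c < n" for r c
    using that i by (auto simp: mat_delete_def C lap_def mult_ac)
qed

lemma det_forms:
  fixes M :: "(nat, 'k::comm_ring_1) mpoly mat"
  assumes M: "M \<in> carrier_mat N N" and "\<And>i j. i < N \<Longrightarrow> j < N \<Longrightarrow> M $$ (i, j) \<in> forms n (Suc 0)"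
  shows "det M \<in> forms n N"
  unfolding det_def'[OF M]
proof (intro forms_sum)
  fix p assume "p \<in> {p. p permutes {0..<N}}"
  then have "p i < N" if "i < N" for i
    using that permutes_in_image[of p "{0..<N}" i] by simp
  then have "(\<Prod>i\<in>{0..<N}. M $$ (i, p i)) \<in> forms n (card {0..<N})"
    by (intro forms_prod) (auto intro!: assms)
  then show "signof p * (\<Prod>i = 0..<N. M $$ (i, p i)) \<in> forms n N"
    by (cases "sign p = 1") (auto simp: sign_def forms_uminus split: if_splits)
qed

lemma lap_minor_forms:
  assumes "i \<le> n"
  shows "lap_minor n (\<lambda>i j. Cst (a i j)) Var i \<in> forms n n"
proof -
  have "lap n (\<lambda>i j. Cst (a i j)) Var $$ (r, c) \<in> forms n (Suc 0)" if "r \<le> n" "c \<le> n" for r c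
    using that by (auto simp: lap_index intro!: forms_uminus forms_sum forms_Cst_mult forms_Var)
  then show ?thesis unfolding lap_minor_def
    using assms mat_delete_carrier[OF lap_carrier]
    by (intro det_forms) (auto simp: mat_delete_def)
qed

section \<open>The maps attached to a weight matrix\<close>

abbreviation W_form :: "nat \<Rightarrow> (nat \<Rightarrow> nat \<Rightarrow> 'k::field) \<Rightarrow> nat \<Rightarrow> (nat, 'k) mpoly" where
  "W_form n a i \<equiv> lap_minor n (\<lambda>i j. Cst (a i j)) Var i"

lemma B_mat_eq_lap: "B_mat n a = lap n (\<lambda>i j. Cst (a i j)) Var"
  by (rule eq_matI) (auto simp: B_mat_def lap_def f_form_def)

lemma det_B_minor: "det (mat_delete (B_mat n a) i i) = W_form n a i"
  by (simp add: B_mat_eq_lap lap_minor_def)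

lemma ev_W_form: "i \<le> n \<Longrightarrow> mpeval (\<lambda>a. a) p (W_form n a i) = lap_minor n a p i"
  by (simp add: ev.hom_lap_minor)

lemma ev_ac_W_form: "i \<le> n \<Longrightarrow> mpeval to_ac p (W_form n a i) = lap_minor n (\<lambda>i j. to_ac (a i j)) p i"
  by (simp add: ev_ac.hom_lap_minor)

lemma subst_W_form: "i \<le> n \<Longrightarrow> mpeval Cst \<sigma> (W_form n a i) = lap_minor n (\<lambda>i j. Cst (a i j)) \<sigma> i"
  by (simp add: subst.hom_lap_minor)

definition unit_pt :: "nat \<Rightarrow> nat \<Rightarrow> 'k::zero_neq_one" where
  "unit_pt k = (\<lambda>j. if j = k then 1 else 0)"

lemma zero_locus_ideal_of_two: "zero_locus n (ideal_of_two n F G) = zero_locus n {F, G}"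
proof -
  have "F = 1 * F + 0 * G" "G = 0 * F + 1 * G" by simp_all
  then have "F \<in> ideal_of_two n F G" "G \<in> ideal_of_two n F G"
    unfolding ideal_of_two_def using polys_0 polys_1 by blast+
  then show ?thesis
    by (auto simp: zero_locus_def) (auto simp: ideal_of_two_def ev_ac.hom_add ev_ac.hom_mult)
qed

lemma Var_eq_lin_form:
  "k \<le> n \<Longrightarrow> (Var k :: (nat, 'k::comm_ring_1) mpoly) = lin_form n (unit_pt k)"
  by (simp add: lin_form_def unit_pt_def if_distrib[of Cst] if_distrib[of "\<lambda>x. x * _"] sum.delta cong: if_cong)

lemma f_form_eq_lin_form:
  "i \<le> n \<Longrightarrow> f_form n a i = lin_form n (\<lambda>j. if j \<le> n \<and> j \<noteq> i then a i j else 0)"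
  unfolding lin_form_def f_form_def by (subst sum.remove[of "{..n}" i]) (auto intro!: sum.cong)

locale weights =
  fixes n :: nat and a :: "nat \<Rightarrow> nat \<Rightarrow> 'k::field"
  assumes n: "n \<ge> 1" and a: "\<And>i j. i \<le> n \<Longrightarrow> j \<le> n \<Longrightarrow> i \<noteq> j \<Longrightarrow> a i j \<noteq> 0"
begin

lemma weights_transposed: "weights n (\<lambda>i j. a j i)"
  by standard (use n a in auto)

lemma obtain_other: obtains k where "k \<le> n" "k \<noteq> i"
  using n by (metis One_nat_def le0 not_one_le_zero)

lemma W_form_at_unit_pt:
  assumes "i \<le> n" "k \<le> n"
  shows "lap_minor n a (unit_pt k) i = 0 \<longleftrightarrow> i \<noteq> k"
  using assms a lap_minor_unit_vector_0[of i n k "unit_pt k" a] lap_minor_unit_vector[of k n "unit_pt k" a]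
  by (auto simp: unit_pt_def)

lemma Q_form_eq: "i \<le> n \<Longrightarrow> Var i * Q_form n a i = W_form n a i"
proof -
  assume i: "i \<le> n"
  then obtain Q where Q: "W_form n a i = Var i * Q"
    using coordinate_dvd_lap_minor[of n i Var] n by (auto elim: dvdE)
  have "Q_form n a i = Q"
    unfolding Q_form_def det_B_minor by (rule the_equality) (auto simp: Q)
  with Q show ?thesis by simp
qed

lemma v_map_eq: "i \<le> n \<Longrightarrow> v_map n a i = W_form n a i"
  by (simp add: v_map_def Q_form_eq)

lemma Q_form_forms: "i \<le> n \<Longrightarrow> Q_form n a i \<in> forms n (n - 1)"
  using forms_cancel_Var[of i "Q_form n a i" n n] lap_minor_forms[of i n a] by (simp add: Q_form_eq)

text \<open>The forms \<open>x\<^sub>j Q\<^sub>j\<close> are independent because \<open>x\<^sub>j Q\<^sub>j\<close> is the only one not vanishing at the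
  \<open>j\<close>-th coordinate point.\<close>

lemma W_form_independent:
  assumes "(\<Sum>j\<le>n. Cst (\<beta> j) * W_form n a j) = (\<Sum>j\<le>n. Cst (\<gamma> j) * W_form n a j)" "k \<le> n"
  shows "\<beta> k = \<gamma> k"
proof -
  have "mpeval (\<lambda>a. a) (unit_pt k) (\<Sum>j\<le>n. Cst (\<beta> j) * W_form n a j) = \<beta> k * lap_minor n a (unit_pt k) k" for \<beta>
  proof -
    have "mpeval (\<lambda>a. a) (unit_pt k) (\<Sum>j\<le>n. Cst (\<beta> j) * W_form n a j) =
      (\<Sum>j\<le>n. \<beta> j * lap_minor n a (unit_pt k) j)"
      by (simp add: ev.hom_sum ev.hom_mult ev_W_form)
    also have "\<dots> = (\<Sum>j\<in>{k}. \<beta> j * lap_minor n a (unit_pt k) j)"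
      using assms(2) by (intro sum.mono_neutral_right) (auto simp: W_form_at_unit_pt)
    finally show ?thesis by simp
  qed
  from this[of \<beta>] this[of \<gamma>] show ?thesis
    using assms W_form_at_unit_pt[of k k] by simp
qed

text \<open>Cancel \<open>x\<^sub>i\<close> in \<open>lap_minor_balance\<close>.\<close>

lemma is_b_row_iff:
  assumes i: "i \<le> n"
  shows "is_b_row n a i \<beta> \<longleftrightarrow> \<beta> = (\<lambda>j. if j \<le> n \<and> j \<noteq> i then a j i else 0)" (is "_ \<longleftrightarrow> \<beta> = ?b")
proof -
  have "Var i * (f_form n a i * Q_form n a i) = W_form n a i * f_form n a i"
    using i by (simp add: mult_ac flip: Q_form_eq)
  also have "\<dots> = Var i * (\<Sum>j\<in>{..n} - {i}. Cst (a j i) * W_form n a j)"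
    unfolding f_form_def by (rule lap_minor_balance[OF i])
  also have "(\<Sum>j\<in>{..n} - {i}. Cst (a j i) * W_form n a j) = (\<Sum>j\<le>n. Cst (?b j) * W_form n a j)"
    using i by (subst sum.remove[of "{..n}" i]) (auto intro!: sum.cong)
  finally have eq: "f_form n a i * Q_form n a i = (\<Sum>j\<le>n. Cst (?b j) * W_form n a j)"
    by simp
  have "is_b_row n a i \<beta> \<longleftrightarrow> (\<forall>j>n. \<beta> j = 0) \<and>
      (\<Sum>j\<le>n. Cst (?b j) * W_form n a j) = (\<Sum>j\<le>n. Cst (\<beta> j) * W_form n a j)"
    unfolding is_b_row_def eq by (simp add: Q_form_eq)
  also have "\<dots> \<longleftrightarrow> \<beta> = ?b"
  proof
    assume *: "(\<forall>j>n. \<beta> j = 0) \<and>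
      (\<Sum>j\<le>n. Cst (?b j) * W_form n a j) = (\<Sum>j\<le>n. Cst (\<beta> j) * W_form n a j)"
    show "\<beta> = ?b"
    proof
      fix j show "\<beta> j = ?b j"
        using * W_form_independent[of ?b \<beta> j] by (cases "j \<le> n") auto
    qed
  qed auto
  finally show ?thesis .
qed

lemma g_form_eq:
  assumes "i \<le> n"
  shows "g_form n a i = f_form n (\<lambda>i j. a j i) i"
proof -
  have "b_coeff n a i = (\<lambda>j. if j \<le> n \<and> j \<noteq> i then a j i else 0)"
    unfolding b_coeff_def is_b_row_iff[OF assms] by simp
  then show ?thesis
    using f_form_eq_lin_form[OF assms, of "\<lambda>i j. a j i"] by (simp add: g_form_def lin_form_def)
qed

text \<open>Since \<open>g\<^sub>i\<close> is the form \<open>f\<^sub>i\<close> of the transposed weights, \<open>C\<close> is diagonally conjugate to the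
  transpose of the matrix \<open>B\<close> of these weights. So \<open>u\<close> is the map \<open>v\<close> of the transposed weights.\<close>

lemma u_map_eq: "i \<le> n \<Longrightarrow> u_map n a i = W_form n (\<lambda>i j. a j i) i"
  unfolding u_map_def
  by (rule lap_minor_transposed_weights)
     (auto simp: C_mat_def g_form_eq f_form_def intro!: eq_matI)

text \<open>By \<open>lap_minor_unique\<close>, the composite at \<open>x\<close> is the only solution, up to a factor, of the balance
  relations for the transposed weights at the point \<open>v(x)\<close>. But \<open>x\<close> is a solution too: these are
  the relations \<open>lap_minor_balance\<close> for \<open>v(x)\<close>, with the two sides exchanged.\<close>

lemma W_form_transposed_comp:
  assumes F: "\<And>i. i \<le> n \<Longrightarrow> F i = W_form n (\<lambda>i j. a j i) i"
    and G: "\<And>i. i \<le> n \<Longrightarrow> G i = W_form n a i"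
  shows "same_rat_map n (rat_comp F G) Var"
proof -
  let ?X = "\<lambda>j. W_form n a j"
  have FG: "rat_comp F G i = lap_minor n (\<lambda>i j. Cst (a j i)) ?X i" if "i \<le> n" for i
    using that G by (simp add: rat_comp_def F subst_W_form) (rule lap_minor_cong, simp)
  interpret T: weights n "\<lambda>i j. a j i" by (rule weights_transposed)
  have "rat_comp F G 0 \<noteq> 0"
  proof -
    have "mpeval (\<lambda>a. a) (unit_pt 0) (rat_comp F G 0) =
      lap_minor n (\<lambda>i j. a j i) (\<lambda>j. mpeval (\<lambda>a. a) (unit_pt 0) (W_form n a j)) 0"
      by (simp add: FG ev.hom_lap_minor)
    also have "\<dots> = lap_minor n (\<lambda>i j. a j i) (\<lambda>j. lap_minor n a (unit_pt 0) j) 0"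
      by (rule lap_minor_cong) (simp add: ev_W_form)
    also have "\<dots> \<noteq> 0"
      by (rule lap_minor_unit_vector) (use T.a in \<open>auto simp: W_form_at_unit_pt\<close>)
    finally show ?thesis by auto
  qed
  moreover have "Var i * rat_comp F G j = Var j * rat_comp F G i" if "i \<le> n" "j \<le> n" for i j
    unfolding FG[OF that(1)] FG[OF that(2)]
    by (rule lap_minor_unique) (use that lap_minor_balance[of _ n "\<lambda>i j. Cst (a i j)" Var] in auto)
  ultimately show ?thesis
    unfolding same_rat_map_def by (metis Var_neq_0 le0 mult.commute)
qed

lemma mutually_inverse: "mutually_inverse n (u_map n a) (v_map n a)"
  unfolding mutually_inverse_def
proof
  show "same_rat_map n (rat_comp (u_map n a) (v_map n a)) Var"
    by (rule W_form_transposed_comp) (simp_all add: u_map_eq v_map_eq)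
  interpret T: weights n "\<lambda>i j. a j i" by (rule weights_transposed)
  show "same_rat_map n (rat_comp (v_map n a) (u_map n a)) Var"
    by (rule T.W_form_transposed_comp) (simp_all add: u_map_eq v_map_eq)
qed

lemma Pi_star_eq:
  assumes "k \<le> n"
  shows "Pi_star n a k = zero_locus n {lin_form n (unit_pt k),
    lin_form n (\<lambda>j. if j \<le> n \<and> j \<noteq> k then a j k else 0)}"
  using assms unfolding Pi_star_def zero_locus_ideal_of_two
  by (simp add: Var_eq_lin_form g_form_eq f_form_eq_lin_form)

lemma Pi_star_codim2:
  assumes k: "k \<le> n"
  shows "Pi_star n a k \<in> codim2_subspaces n"
proof -
  obtain j where j: "j \<le> n" "j \<noteq> k" by (rule obtain_other)
  have "lin_indep2 n (unit_pt k) (\<lambda>j. if j \<le> n \<and> j \<noteq> k then a j k else 0)"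
    unfolding lin_indep2_def
  proof (intro allI impI)
    fix s t
    assume *: "\<forall>j\<le>n. s * unit_pt k j + t * (if j \<le> n \<and> j \<noteq> k then a j k else 0) = 0"
    from *[rule_format, OF j(1)] j a[of j k] k have "t = 0" by (simp add: unit_pt_def)
    with *[rule_format, OF k] show "s = 0 \<and> t = 0" by (simp add: unit_pt_def)
  qed
  then show ?thesis using k unfolding codim2_subspaces_def Pi_star_eq[OF k] by blast
qed

text \<open>On \<open>\<Pi>\<^sub>k\<^sup>*\<close> column \<open>k\<close> of the transposed weight matrix is zero, which kills the minors with
  \<open>i \<noteq> k\<close>; the \<open>k\<close>-th minor is a multiple of \<open>y\<^sub>k\<close>.\<close>

lemma u_map_vanishes:
  assumes "i \<le> n" "k \<le> n" "p \<in> Pi_star n a k"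
  shows "mpeval to_ac p (u_map n a i) = 0"
proof -
  have "p \<in> zero_locus n {Var k, f_form n (\<lambda>i j. a j i) k}"
    using assms by (simp add: Pi_star_def zero_locus_ideal_of_two g_form_eq)
  then have p: "p k = 0" "(\<Sum>j\<in>{..n} - {k}. to_ac (a j k) * p j) = 0"
    by (simp_all add: zero_locus_def f_form_def ev_ac.hom_sum ev_ac.hom_mult)
  have "lap_minor n (\<lambda>i j. to_ac (a j i)) p i = 0"
  proof (cases "i = k")
    case True
    then show ?thesis
      using coordinate_dvd_lap_minor[of n i p "\<lambda>i j. to_ac (a j i)"] n assms p by simp
  next
    case False
    then show ?thesis using assms p by (intro lap_minor_zero_column[of i n k]) auto
  qed
  then show ?thesis using assms by (simp add: u_map_eq ev_ac_W_form)
qed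

lemma u_map_forms: "i \<le> n \<Longrightarrow> u_map n a i \<in> forms n n"
  using lap_minor_forms[of i n "\<lambda>i j. a j i"] by (simp add: u_map_eq)

lemma u_map_nonzero:
  assumes "i \<le> n"
  shows "u_map n a i \<noteq> 0"
proof -
  interpret T: weights n "\<lambda>i j. a j i" by (rule weights_transposed)
  have "mpeval (\<lambda>a. a) (unit_pt i) (u_map n a i) \<noteq> 0"
    using assms T.W_form_at_unit_pt[of i i] by (simp add: u_map_eq ev_W_form)
  then show ?thesis by auto
qed

end

section \<open>Nonvanishing of polynomials over infinite fields\<close>

lemma digits_unique:
  fixes f g :: "nat \<Rightarrow> nat"
  assumes "\<And>v. v < V \<Longrightarrow> f v < N" "\<And>v. v < V \<Longrightarrow> g v < N"
    and "(\<Sum>v<V. f v * N ^ v) = (\<Sum>v<V. g v * N ^ v)" "v < V"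
  shows "f v = g v"
  using assms
proof (induction V arbitrary: v)
  case (Suc V)
  have bound: "(\<Sum>v<W. h v * N ^ v) < N ^ W" if "\<And>v. v < W \<Longrightarrow> h v < N" for W and h :: "nat \<Rightarrow> nat"
    using that
  proof (induction W)
    case (Suc W)
    have "(\<Sum>v<W. h v * N ^ v) < N ^ W" using Suc by simp
    moreover have "(h W + 1) * N ^ W \<le> N * N ^ W"
      using Suc.prems[of W] by (intro mult_right_mono) auto
    ultimately show ?case by simp
  qed simp
  have top: "(\<Sum>v<Suc V. h v * N ^ v) div N ^ V = h V" if "\<And>v. v < Suc V \<Longrightarrow> h v < N" for h :: "nat \<Rightarrow> nat"
  proof -
    have "(\<Sum>v<V. h v * N ^ v) < N ^ V" by (rule bound) (simp add: that)
    moreover from this have "N ^ V \<noteq> 0" by linarith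
    ultimately show ?thesis
      using div_mult_self1[of "N ^ V" "\<Sum>v<V. h v * N ^ v" "h V"] by simp
  qed
  have "f V = g V"
    using top[of f] top[of g] Suc.prems by simp
  with Suc.prems have "(\<Sum>v<V. f v * N ^ v) = (\<Sum>v<V. g v * N ^ v)" by simp
  with Suc.IH[of v] Suc.prems \<open>f V = g V\<close> show ?case
    by (cases "v = V") auto
qed simp

text \<open>Kronecker substitution \<open>x\<^sub>v \<mapsto> t\<^bsup>N\<^sup>v\<^esup>\<close> keeps finitely many monomials distinct, which reduces the
  claim to polynomials in one variable.\<close>

lemma mpoly_nonvanishing:
  fixes F :: "(nat, 'k::field_char_0) mpoly"
  assumes "F \<noteq> 0"
  obtains q where "mpeval (\<lambda>a. a) q F \<noteq> 0"
proof -
  let ?K = "Poly_Mapping.keys F"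
  obtain V where V: "\<And>m. m \<in> ?K \<Longrightarrow> Poly_Mapping.keys m \<subseteq> {..<V}"
  proof -
    have "finite (\<Union>m\<in>?K. Poly_Mapping.keys m)" by simp
    then obtain V where "\<forall>v\<in>(\<Union>m\<in>?K. Poly_Mapping.keys m). v < V"
      using finite_nat_set_iff_bounded by blast
    then show ?thesis by (intro that[of V]) auto
  qed
  obtain N where N: "\<And>m v. m \<in> ?K \<Longrightarrow> v < V \<Longrightarrow> Poly_Mapping.lookup m v < N"
  proof -
    have "finite (\<Union>m\<in>?K. Poly_Mapping.lookup m ` {..<V})" by simp
    then obtain N where "\<forall>e\<in>(\<Union>m\<in>?K. Poly_Mapping.lookup m ` {..<V}). e < N"
      using finite_nat_set_iff_bounded by blast
    then show ?thesis by (intro that[of N]) auto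
  qed
  define e where "e m = (\<Sum>v<V. Poly_Mapping.lookup m v * N ^ v)" for m :: "nat \<Rightarrow>\<^sub>0 nat"
  have inj: "inj_on e ?K"
  proof (rule inj_onI)
    fix m m' assume m: "m \<in> ?K" "m' \<in> ?K" "e m = e m'"
    show "m = m'"
    proof (rule poly_mapping_eqI)
      fix v
      show "Poly_Mapping.lookup m v = Poly_Mapping.lookup m' v"
      proof (cases "v < V")
        case True
        then show ?thesis
          using digits_unique[of V "Poly_Mapping.lookup m" N "Poly_Mapping.lookup m'" v] N m
          unfolding e_def by blast
      next
        case False
        then have "v \<notin> Poly_Mapping.keys m" "v \<notin> Poly_Mapping.keys m'"
          using V[OF m(1)] V[OF m(2)] by blast+
        then show ?thesis by (simp add: in_keys_iff)
      qed
    qed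
  qed
  define u where "u = mpeval (\<lambda>c. [:c:]) (\<lambda>v. Polynomial.monom 1 (N ^ v)) F"
  have pw: "Polynomial.monom (1::'k) d ^ k = Polynomial.monom 1 (k * d)" for d k
    by (induction k) (simp_all add: mult_monom)
  have pr: "(\<Prod>v\<in>S. Polynomial.monom (1::'k) (g v)) = Polynomial.monom 1 (\<Sum>v\<in>S. g v)"
    if "finite S" for S :: "nat set" and g
    using that by (induction S) (simp_all add: mult_monom)
  have u: "u = (\<Sum>m\<in>?K. Polynomial.monom (Poly_Mapping.lookup F m) (e m))"
    unfolding u_def
  proof (subst mpeval_superset[of _ ?K], goal_cases)
    case 4
    have "mon_eval (\<lambda>v. Polynomial.monom (1::'k) (N ^ v)) m = Polynomial.monom 1 (e m)" if "m \<in> ?K" for m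
      using V[OF that] by (simp add: mon_eval_superset[of "{..<V}"] pw pr e_def)
    then show ?case by (intro sum.cong) (simp_all add: smult_monom)
  qed auto
  obtain m0 where m0: "m0 \<in> ?K" using assms by (metis all_not_in_conv keys_eq_empty)
  have "Polynomial.coeff u (e m0) = (\<Sum>m\<in>?K. if m = m0 then Poly_Mapping.lookup F m else 0)"
    unfolding u coeff_sum
    using inj m0 by (intro sum.cong) (auto simp: inj_on_eq_iff)
  also have "\<dots> \<noteq> 0" using m0 by (simp add: in_keys_iff)
  finally have "u \<noteq> 0" by auto
  then have "finite {t. poly u t = 0}" by (rule poly_roots_finite)
  then obtain t where "poly u t \<noteq> 0"
    using infinite_UNIV_char_0[where 'a = 'k] by (metis (mono_tags, lifting) UNIV_eq_I mem_Collect_eq)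
  moreover have ht: "comm_ring_hom (\<lambda>f::'k poly. poly f t)" by standard simp_all
  have "poly u t = mpeval (\<lambda>a. a) (\<lambda>v. t ^ N ^ v) F"
    unfolding u_def comm_ring_hom.hom_mpeval[OF ht] by (simp add: poly_monom)
  ultimately show ?thesis using that by metis
qed

section \<open>Linear subspaces of codimension two\<close>

lemma ev_ac_lin_form: "mpeval to_ac p (lin_form n l) = (\<Sum>j\<le>n. to_ac (l j) * p j)"
  by (simp add: lin_form_def ev_ac.hom_sum ev_ac.hom_mult)

lemma lin_indep2_minor:
  assumes "lin_indep2 n l m"
  obtains j1 j2 where "j1 \<le> n" "j2 \<le> n" "l j1 * m j2 - l j2 * m j1 \<noteq> 0"
proof (rule ccontr)
  note witness = that
  assume no: "\<not> thesis"
  have *: "l j1 * m j2 - l j2 * m j1 = 0" if "j1 \<le> n" "j2 \<le> n" for j1 j2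
    using no witness that by blast
  have "\<exists>j1\<le>n. l j1 \<noteq> 0"
    using assms[unfolded lin_indep2_def, rule_format, of 1 0] by auto
  then obtain j1 where j1: "j1 \<le> n" "l j1 \<noteq> 0" by blast
  have "\<forall>j\<le>n. m j1 * l j + (- l j1) * m j = 0"
    using *[OF j1(1)] by (auto simp: algebra_simps)
  with assms have "- l j1 = 0" unfolding lin_indep2_def by blast
  with j1(2) show False by simp
qed

lemma lin_indep2_if_minor:
  fixes l m :: "nat \<Rightarrow> 'k::field"
  assumes "j1 \<le> n" "j2 \<le> n" "l j1 * m j2 - l j2 * m j1 \<noteq> 0"
  shows "lin_indep2 n l m"
  unfolding lin_indep2_def
proof (intro allI impI)
  fix s t assume *: "\<forall>j\<le>n. s * l j + t * m j = 0"
  have "s * (l j1 * m j2 - l j2 * m j1) = m j2 * (s * l j1 + t * m j1) - m j1 * (s * l j2 + t * m j2)"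
    "t * (l j1 * m j2 - l j2 * m j1) = l j1 * (s * l j2 + t * m j2) - l j2 * (s * l j1 + t * m j1)"
    by (simp_all add: algebra_simps)
  then show "s = 0 \<and> t = 0" using * assms by simp
qed

text \<open>It suffices to test \<open>r\<close> on the solutions of \<open>l = m = 0\<close> supported on three coordinates that
  Cramer's rule provides; these have coordinates in the ground field.\<close>

lemma vanishing_linear_form:
  fixes l m r :: "nat \<Rightarrow> 'k::field"
  assumes ind: "lin_indep2 n l m"
    and r: "\<And>p. p \<in> zero_locus n {lin_form n l, lin_form n m} \<Longrightarrow> (\<Sum>j\<le>n. to_ac (r j) * p j) = 0"
  shows "\<exists>s t. \<forall>j\<le>n. r j = s * l j + t * m j"
proof -
  obtain j1 j2 where j12: "j1 \<le> n" "j2 \<le> n" and D0: "l j1 * m j2 - l j2 * m j1 \<noteq> 0"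
    using lin_indep2_minor[OF ind] .
  define D where "D = l j1 * m j2 - l j2 * m j1"
  have "r j = (r j1 * m j2 - r j2 * m j1) / D * l j + (l j1 * r j2 - l j2 * r j1) / D * m j"
    if j: "j \<le> n" for j
  proof -
    \<comment> \<open>the combination of the unit vectors \<open>e\<^sub>j\<close>, \<open>e\<^sub>j\<^sub>1\<close>, \<open>e\<^sub>j\<^sub>2\<close> killed by \<open>l\<close> and \<open>m\<close>;
      it is zero if \<open>j\<close> is \<open>j1\<close> or \<open>j2\<close>\<close>
    define u v where "u = - (l j * m j2 - l j2 * m j)" and "v = - (l j1 * m j - l j * m j1)"
    define p where "p k = (if k = j then D else 0) + (if k = j1 then u else 0) + (if k = j2 then v else 0)" for k
    have sum_p: "(\<Sum>k\<le>n. z k * p k) = z j * D + z j1 * u + z j2 * v" for z :: "nat \<Rightarrow> 'k"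
      using j j12 unfolding p_def
      by (simp add: distrib_left sum.distrib if_distrib[of "\<lambda>x. _ * x"] sum.delta cong: if_cong)
    have sum_ac: "(\<Sum>k\<le>n. to_ac (z k) * to_ac (p k)) = to_ac (z j * D + z j1 * u + z j2 * v)" for z :: "nat \<Rightarrow> 'k"
      unfolding sum_p[symmetric] by (simp add: to_ac_sum)
    have "r j * D + r j1 * u + r j2 * v = 0"
    proof (cases "\<exists>k\<le>n. p k \<noteq> 0")
      case False
      then show ?thesis using sum_p[of r] by simp
    next
      case True
      moreover have "p k = 0" if "k > n" for k using that j j12 by (auto simp: p_def)
      moreover have "l j * D + l j1 * u + l j2 * v = 0" "m j * D + m j1 * u + m j2 * v = 0"
        by (simp_all add: D_def u_def v_def algebra_simps)
      ultimately have "(\<lambda>k. to_ac (p k)) \<in> zero_locus n {lin_form n l, lin_form n m}"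
        by (auto simp: zero_locus_def proj_points_def ev_ac_lin_form sum_ac)
      from r[OF this] show ?thesis unfolding sum_ac by (simp only: to_ac_eq_0_iff)
    qed
    then have "r j * D = (r j1 * m j2 - r j2 * m j1) * l j + (l j1 * r j2 - l j2 * r j1) * m j"
      by (simp add: u_def v_def algebra_simps)
    then have "r j = ((r j1 * m j2 - r j2 * m j1) * l j + (l j1 * r j2 - l j2 * r j1) * m j) / D"
      using D0 by (intro eq_divide_imp) (simp_all add: D_def)
    then show ?thesis by (simp add: add_divide_distrib)
  qed
  then show ?thesis by blast
qed

definition weight_plane :: "nat \<Rightarrow> (nat \<Rightarrow> nat \<Rightarrow> 'k::field) \<Rightarrow> nat \<Rightarrow> (nat \<Rightarrow> 'k alg_closure) set" where
  "weight_plane n a i = {q \<in> proj_points n. q i = 0 \<and> (\<Sum>j\<in>{..n} - {i}. to_ac (a i j) * q j) = 0}"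

lemma ideal_of_two_add: "F \<in> ideal_of_two n P Q \<Longrightarrow> G \<in> ideal_of_two n P Q \<Longrightarrow> F + G \<in> ideal_of_two n P Q"
proof -
  assume "F \<in> ideal_of_two n P Q" "G \<in> ideal_of_two n P Q"
  then obtain A B A' B' where *: "F = A * P + B * Q" "G = A' * P + B' * Q"
    and p: "A \<in> polys n" "B \<in> polys n" "A' \<in> polys n" "B' \<in> polys n"
    unfolding ideal_of_two_def by blast
  have "F + G = (A + A') * P + (B + B') * Q" unfolding * by (simp add: algebra_simps)
  with p show ?thesis unfolding ideal_of_two_def using polys_add by blast
qed

lemma ideal_of_two_mult: "F \<in> ideal_of_two n P Q \<Longrightarrow> G \<in> polys n \<Longrightarrow> G * F \<in> ideal_of_two n P Q"
proof -
  assume "F \<in> ideal_of_two n P Q" and G: "G \<in> polys n"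
  then obtain A B where *: "F = A * P + B * Q" and p: "A \<in> polys n" "B \<in> polys n"
    unfolding ideal_of_two_def by blast
  have "G * F = (G * A) * P + (G * B) * Q" unfolding * by (simp add: algebra_simps)
  with p G show ?thesis unfolding ideal_of_two_def using polys_mult by blast
qed

lemma ideal_of_two_0: "0 \<in> ideal_of_two n P Q"
  and ideal_of_two_left: "P \<in> ideal_of_two n P Q"
  and ideal_of_two_right: "Q \<in> ideal_of_two n P Q"
proof -
  have "0 = 0 * P + 0 * Q" "P = 1 * P + 0 * Q" "Q = 0 * P + 1 * Q" by simp_all
  then show "0 \<in> ideal_of_two n P Q" "P \<in> ideal_of_two n P Q" "Q \<in> ideal_of_two n P Q"
    unfolding ideal_of_two_def using polys_0 polys_1 by blast+
qed

text \<open>The residue ring is a polynomial ring in \<open>n - 1 \<ge> 1\<close> variables: the substitution \<open>\<sigma>\<close>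
  eliminates \<open>x\<^sub>i\<close> and \<open>x\<^sub>j\<close> modulo the ideal, and the values of the
  eliminated polynomial are values of the original one at points of the subspace.\<close>

lemma vanishing_ideal_weight_plane:
  fixes a :: "nat \<Rightarrow> nat \<Rightarrow> 'k::field_char_0"
  assumes n: "n \<ge> 2" and i: "i \<le> n" and a: "\<And>j. j \<le> n \<Longrightarrow> j \<noteq> i \<Longrightarrow> a i j \<noteq> 0"
  shows "vanishing_ideal n (weight_plane n a i) = ideal_of_two n (Var i) (f_form n a i)"
proof
  let ?I = "ideal_of_two n (Var i) (f_form n a i)"
  have ff: "f_form n a i \<in> polys n"
    unfolding f_form_def by (auto intro!: polys_sum polys_mult)
  show "?I \<subseteq> vanishing_ideal n (weight_plane n a i)"
  proof
    fix F assume "F \<in> ?I"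
    then obtain A B where F: "F = A * Var i + B * f_form n a i" "A \<in> polys n" "B \<in> polys n"
      unfolding ideal_of_two_def by blast
    moreover have "F \<in> polys n" unfolding F(1) using F ff i by (auto intro!: polys_add polys_mult)
    ultimately show "F \<in> vanishing_ideal n (weight_plane n a i)"
      by (auto simp: vanishing_ideal_def weight_plane_def ev_ac.hom_add ev_ac.hom_mult f_form_def ev_ac.hom_sum)
  qed
  show "vanishing_ideal n (weight_plane n a i) \<subseteq> ?I"
  proof
    fix F assume "F \<in> vanishing_ideal n (weight_plane n a i)"
    then have F: "F \<in> polys n" and van: "\<And>p. p \<in> weight_plane n a i \<Longrightarrow> mpeval to_ac p F = 0"
      by (auto simp: vanishing_ideal_def)
    have "card ({..n} - {i}) \<ge> 2" using n i by simp
    then obtain j where "j \<in> {..n} - {i}" by (metis all_not_in_conv card.empty not_numeral_le_zero)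
    then have j: "j \<le> n" "j \<noteq> i" by auto
    have "card ({..n} - {i} - {j}) \<ge> 1" using n i j by simp
    then obtain k where "k \<in> {..n} - {i} - {j}" by (metis all_not_in_conv card.empty not_one_le_zero)
    then have k: "k \<le> n" "k \<noteq> i" "k \<noteq> j" by auto
    have aij: "a i j \<noteq> 0" using a j by simp
    let ?R = "\<Sum>l\<in>{..n} - {i} - {j}. Cst (a i l) * Var l :: (nat, 'k) mpoly"
    define \<sigma> :: "nat \<Rightarrow> (nat, 'k) mpoly" where
      "\<sigma> v = (if v = i then 0 else if v = j then - (Cst (1 / a i j) * ?R) else Var v)" for v
    have f_split: "f_form n a i = Cst (a i j) * Var j + ?R"
      unfolding f_form_def using j by (subst sum.remove[of _ j]) auto
    have \<sigma>: "\<sigma> v \<in> polys n" if "v \<le> n" for v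
      unfolding \<sigma>_def using that by (auto intro!: polys_uminus polys_mult polys_sum)
    have "F - mpeval Cst \<sigma> F \<in> ?I \<and> mpeval Cst \<sigma> F \<in> polys n"
      using F
    proof (induction rule: polys_induct)
      case (Cst c)
      show ?case by (simp add: ideal_of_two_0)
    next
      case (Var v)
      consider "v = i" | "v = j" | "v \<noteq> i" "v \<noteq> j" by blast
      then have "Var v - \<sigma> v \<in> ?I"
      proof cases
        case 1
        then show ?thesis by (simp add: \<sigma>_def ideal_of_two_left)
      next
        case 2
        have "Cst (1 / a i j) * f_form n a i = Cst (1 / a i j) * Cst (a i j) * Var j + Cst (1 / a i j) * ?R"
          unfolding f_split by (simp add: algebra_simps)
        also have "Cst (1 / a i j) * Cst (a i j) = (1 :: (nat, 'k) mpoly)"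
          using aij by (simp flip: Cst.hom_mult)
        finally have "Var v - \<sigma> v = Cst (1 / a i j) * f_form n a i"
          using 2 j by (simp add: \<sigma>_def)
        then show ?thesis by (simp only: ideal_of_two_mult[OF ideal_of_two_right polys_Cst])
      next
        case 3
        then show ?thesis by (simp add: \<sigma>_def ideal_of_two_0)
      qed
      then show ?case using \<sigma>[OF Var] by simp
    next
      case (add F G)
      have "F + G - mpeval Cst \<sigma> (F + G) = (F - mpeval Cst \<sigma> F) + (G - mpeval Cst \<sigma> G)"
        by (simp add: subst.hom_add)
      also have "\<dots> \<in> ?I" using add by (blast intro: ideal_of_two_add)
      finally show ?case using add by (simp add: subst.hom_add polys_add)
    next
      case (mult F G)
      have "F * G - mpeval Cst \<sigma> (F * G) =
          F * (G - mpeval Cst \<sigma> G) + mpeval Cst \<sigma> G * (F - mpeval Cst \<sigma> F)"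
        by (simp add: subst.hom_mult algebra_simps)
      also have "\<dots> \<in> ?I" using mult by (blast intro: ideal_of_two_add ideal_of_two_mult)
      finally show ?case using mult by (simp add: subst.hom_mult polys_mult)
    qed
    then have mem: "F - mpeval Cst \<sigma> F \<in> ?I" by simp
    have "mpeval Cst \<sigma> F = 0"
    proof (rule ccontr)
      assume "mpeval Cst \<sigma> F \<noteq> 0"
      \<comment> \<open>the factor \<open>x\<^sub>k\<close> makes sure that the point found is not the zero vector\<close>
      then have "mpeval Cst \<sigma> F * Var k \<noteq> 0" by simp
      then obtain q where q: "mpeval (\<lambda>a. a) q (mpeval Cst \<sigma> F * Var k) \<noteq> 0"
        by (rule mpoly_nonvanishing)
      define q' where "q' v = (if v \<le> n then mpeval (\<lambda>a. a) q (\<sigma> v) else 0)" for v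
      have "mpeval (\<lambda>a. a) q (mpeval Cst \<sigma> F) = mpeval (\<lambda>a. a) (\<lambda>v. mpeval (\<lambda>a. a) q (\<sigma> v)) F"
        by (simp add: ev.hom_mpeval)
      also have "\<dots> = mpeval (\<lambda>a. a) q' F"
        by (rule mpeval_cong[OF F]) (simp add: q'_def)
      finally have Fq': "mpeval (\<lambda>a. a) q' F \<noteq> 0" and qk: "q k \<noteq> 0"
        using q by (auto simp: ev.hom_mult)
      have "(\<Sum>l\<in>{..n} - {i}. a i l * q' l) = a i j * q' j + (\<Sum>l\<in>{..n} - {i} - {j}. a i l * q' l)"
        using j by (subst sum.remove[of _ j]) auto
      also have "(\<Sum>l\<in>{..n} - {i} - {j}. a i l * q' l) = (\<Sum>l\<in>{..n} - {i} - {j}. a i l * q l)"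
        by (rule sum.cong) (auto simp: q'_def \<sigma>_def)
      also have "a i j * q' j = - (\<Sum>l\<in>{..n} - {i} - {j}. a i l * q l)"
        using j aij by (simp add: q'_def \<sigma>_def ev.hom_uminus ev.hom_mult ev.hom_sum)
      finally have "(\<Sum>l\<in>{..n} - {i}. a i l * q' l) = 0" by simp
      then have "to_ac (\<Sum>l\<in>{..n} - {i}. a i l * q' l) = 0" by simp
      then have "(\<Sum>l\<in>{..n} - {i}. to_ac (a i l) * to_ac (q' l)) = 0" by (simp add: to_ac_sum)
      moreover have "q' k \<noteq> 0" "q' i = 0" using k qk by (simp_all add: q'_def \<sigma>_def)
      ultimately have "(\<lambda>v. to_ac (q' v)) \<in> weight_plane n a i"
        using k(1) by (auto simp: weight_plane_def proj_points_def q'_def)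
      then have "mpeval to_ac (\<lambda>v. to_ac (q' v)) F = 0" by (rule van)
      moreover have "mpeval to_ac (\<lambda>v. to_ac (q' v)) F = to_ac (mpeval (\<lambda>a. a) q' F)"
        by (simp add: to_ac.hom_mpeval)
      ultimately show False using Fq' by simp
    qed
    with mem show "F \<in> ?I" by simp
  qed
qed

section \<open>Changes of coordinates\<close>

lemma coord_change_comp:
  assumes "A \<in> carrier_mat (n + 1) (n + 1)" "B \<in> carrier_mat (n + 1) (n + 1)"
  shows "coord_change n A (coord_change n B p) = coord_change n (A * B) p"
proof
  fix i
  have *: "{0..<Suc n} = {..n}" by auto
  have "(\<Sum>j\<le>n. to_ac (A $$ (i, j)) * (\<Sum>k\<le>n. to_ac (B $$ (j, k)) * p k)) =
      (\<Sum>k\<le>n. to_ac ((A * B) $$ (i, k)) * p k)" if "i \<le> n"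
  proof -
    have "(\<Sum>j\<le>n. to_ac (A $$ (i, j)) * (\<Sum>k\<le>n. to_ac (B $$ (j, k)) * p k)) =
      (\<Sum>j\<le>n. \<Sum>k\<le>n. to_ac (A $$ (i, j)) * to_ac (B $$ (j, k)) * p k)"
      by (simp add: sum_distrib_left mult.assoc)
    also have "\<dots> = (\<Sum>k\<le>n. \<Sum>j\<le>n. to_ac (A $$ (i, j)) * to_ac (B $$ (j, k)) * p k)"
      by (rule sum.swap)
    also have "\<dots> = (\<Sum>k\<le>n. to_ac ((A * B) $$ (i, k)) * p k)"
      using assms that
      by (intro sum.cong) (auto simp: scalar_prod_def * to_ac_sum sum_distrib_right)
    finally show ?thesis .
  qed
  then show "coord_change n A (coord_change n B p) i = coord_change n (A * B) p i"
    by (simp add: coord_change_def)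
qed

lemma coord_change_one:
  assumes "p \<in> proj_points n"
  shows "coord_change n (1\<^sub>m (n + 1)) p = p"
proof
  fix i
  have "(\<Sum>j\<le>n. to_ac (1\<^sub>m (n + 1) $$ (i, j)) * p j) = (\<Sum>j\<le>n. if j = i then p j else 0)" if "i \<le> n"
    using that by (intro sum.cong) auto
  then show "coord_change n (1\<^sub>m (n + 1)) p i = p i"
    using assms by (simp add: coord_change_def proj_points_def)
qed

lemma coord_change_proj:
  assumes "A \<in> carrier_mat (n + 1) (n + 1)" "B \<in> carrier_mat (n + 1) (n + 1)" "B * A = 1\<^sub>m (n + 1)"
    and p: "p \<in> proj_points n"
  shows "coord_change n A p \<in> proj_points n"
proof (rule ccontr)
  assume "coord_change n A p \<notin> proj_points n"
  then have "coord_change n A p i = 0" for i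
    by (cases "i \<le> n") (auto simp: proj_points_def coord_change_def)
  then have "coord_change n B (coord_change n A p) i = 0" for i
    by (simp add: coord_change_def[of n B])
  then have "p i = 0" for i
    using coord_change_comp[OF assms(2,1), of p] coord_change_one[OF p] assms(3) by metis
  then show False using p by (simp add: proj_points_def)
qed

section \<open>Frames admitting adapted coordinates\<close>

text \<open>Cramer's rule: the determinants below compute, up to the common factor \<open>det A\<close>, the coordinates of
  a linear form in the basis given by the rows of \<open>A\<close>.\<close>

lemma det_subst_row_combination:
  assumes A: "A \<in> carrier_mat N N" and j: "j < N"
    and v: "\<And>k. k < N \<Longrightarrow> v k = (\<Sum>r<N. coef r * A $$ (r, k))"
  shows "det (subst_row A j v) = coef j * det A"
proof -
  have cof: "(\<Sum>k<N. A $$ (r, k) * cofactor A j k) = (if r = j then det A else 0)" if "r < N" for r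
    using arg_cong[OF adj_mat(2)[OF A], of "\<lambda>M. M $$ (r, j)"] A j that
    by (simp add: adj_mat_def scalar_prod_def atLeast0LessThan)
  have "det (subst_row A j v) = (\<Sum>k<N. \<Sum>r<N. coef r * (A $$ (r, k) * cofactor A j k))"
    using A j v by (simp add: det_subst_row sum_distrib_right mult.assoc)
  also have "\<dots> = (\<Sum>r<N. coef r * (\<Sum>k<N. A $$ (r, k) * cofactor A j k))"
    unfolding sum_distrib_left by (rule sum.swap)
  also have "\<dots> = coef j * det A"
    using j by (simp add: cof if_distrib[of "\<lambda>x. _ * x"] cong: if_cong)
  finally show ?thesis .
qed

lemma det_nonzero_inverse:
  fixes A :: "'a::field mat"
  assumes A: "A \<in> carrier_mat N N" and d: "det A \<noteq> 0"
  obtains Y where "Y \<in> carrier_mat N N" "A * Y = 1\<^sub>m N" "Y * A = 1\<^sub>m N"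
  using det_non_zero_imp_unit[OF A d, of "()"] that by (auto simp: Units_def ring_mat_def)

lemma det_nonzero_combination:
  fixes A :: "'a::field mat"
  assumes A: "A \<in> carrier_mat N N" and d: "det A \<noteq> 0"
  obtains coef where "\<And>k. k < N \<Longrightarrow> v k = (\<Sum>r<N. coef r * A $$ (r, k))"
proof -
  obtain Y where Y: "Y \<in> carrier_mat N N" "Y * A = 1\<^sub>m N"
    using det_nonzero_inverse[OF A d] by metis
  define coef where "coef r = (\<Sum>k<N. v k * Y $$ (k, r))" for r
  have "v k = (\<Sum>r<N. coef r * A $$ (r, k))" if k: "k < N" for k
  proof -
    have YX: "(\<Sum>r<N. Y $$ (l, r) * A $$ (r, k)) = (if l = k then 1 else 0)" if "l < N" for l
      using arg_cong[OF Y(2), of "\<lambda>M. M $$ (l, k)"] A Y(1) k that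
      by (simp add: scalar_prod_def atLeast0LessThan)
    have "(\<Sum>r<N. coef r * A $$ (r, k)) = (\<Sum>r<N. \<Sum>l<N. v l * (Y $$ (l, r) * A $$ (r, k)))"
      by (simp add: coef_def sum_distrib_right mult.assoc)
    also have "\<dots> = (\<Sum>l<N. v l * (\<Sum>r<N. Y $$ (l, r) * A $$ (r, k)))"
      unfolding sum_distrib_left by (rule sum.swap)
    also have "\<dots> = v k"
      using k by (simp add: YX if_distrib[of "\<lambda>x. _ * x"] cong: if_cong)
    finally show ?thesis by simp
  qed
  then show ?thesis by (rule that)
qed

definition pencil :: "(nat \<times> nat \<times> nat \<Rightarrow> 'k::comm_ring_1) \<Rightarrow> (nat \<Rightarrow> 'k) \<Rightarrow> (nat \<Rightarrow> 'k) \<Rightarrow> nat \<Rightarrow> nat \<Rightarrow> 'k" where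
  "pencil c s t i j = s i * c (i, 0, j) + t i * c (i, 1, j)"

definition pencil_mat :: "nat \<Rightarrow> (nat \<times> nat \<times> nat \<Rightarrow> 'k::comm_ring_1) \<Rightarrow> (nat \<Rightarrow> 'k) \<Rightarrow> (nat \<Rightarrow> 'k) \<Rightarrow> 'k mat" where
  "pencil_mat n c s t = mat (n + 1) (n + 1) (\<lambda>(i, j). pencil c s t i j)"

text \<open>If \<open>x\<^sub>i\<close> and \<open>f\<^sub>i\<close> are the members of the \<open>i\<close>-th pencil with parameters \<open>(s\<^sub>i, t\<^sub>i)\<close> and
  \<open>(p\<^sub>i, q\<^sub>i)\<close>, the factor for \<open>(i, j)\<close> is, by Cramer's rule, the coefficient of \<open>x\<^sub>j\<close> in \<open>f\<^sub>i\<close> times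
  the determinant of the \<open>x\<^sub>i\<close>.\<close>

definition genericity :: "nat \<Rightarrow> (nat \<Rightarrow> 'k) \<Rightarrow> (nat \<Rightarrow> 'k) \<Rightarrow> (nat \<Rightarrow> 'k) \<Rightarrow> (nat \<Rightarrow> 'k)
    \<Rightarrow> (nat \<times> nat \<times> nat \<Rightarrow> 'k) \<Rightarrow> 'k::comm_ring_1" where
  "genericity n s t p q c = det (pencil_mat n c s t) *
     (\<Prod>i\<le>n. \<Prod>j\<in>{..n} - {i}. det (subst_row (pencil_mat n c s t) j (pencil c p q i)))"

lemma pencil_mat_carrier [simp]: "pencil_mat n c s t \<in> carrier_mat (n + 1) (n + 1)"
  by (simp add: pencil_mat_def)

lemma genericity_nonzero_iff:
  "genericity n s t p q (c :: _ \<Rightarrow> 'k::field) \<noteq> 0 \<longleftrightarrow> det (pencil_mat n c s t) \<noteq> 0 \<and>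
     (\<forall>i\<le>n. \<forall>j\<le>n. i \<noteq> j \<longrightarrow> det (subst_row (pencil_mat n c s t) j (pencil c p q i)) \<noteq> 0)"
  unfolding genericity_def by auto

lemma pencil_sum:
  "(\<Sum>j\<le>n. to_ac (pencil c s t i j) * p j) =
     to_ac (s i) * (\<Sum>j\<le>n. to_ac (c (i, 0, j)) * p j) + to_ac (t i) * (\<Sum>j\<le>n. to_ac (c (i, 1, j)) * p j)"
  by (simp add: pencil_def distrib_right sum.distrib sum_distrib_left mult.assoc)

lemma tuple_of_frame_iff:
  "i \<le> n \<Longrightarrow> p \<in> tuple_of_frame n c i \<longleftrightarrow> p \<in> proj_points n \<and>
     (\<Sum>j\<le>n. to_ac (c (i, 0, j)) * p j) = 0 \<and> (\<Sum>j\<le>n. to_ac (c (i, 1, j)) * p j) = 0"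
  by (simp add: tuple_of_frame_def zero_locus_def ev_ac_lin_form)

lemma atMost_eq_lessThan: "{..n::nat} = {..<n + 1}"
  by auto

text \<open>The forms \<open>x\<^sub>i\<close> are the new coordinates and \<open>f\<^sub>i\<close>, reduced modulo \<open>x\<^sub>i\<close>, provides the
  coefficients \<open>a\<^sub>i\<^sub>,\<^sub>j\<close>. That \<open>x\<^sub>i\<close> and \<open>f\<^sub>i\<close> span the \<open>i\<close>-th pencil is automatic: if they were
  proportional, \<open>f\<^sub>i\<close> would have no coefficient at \<open>x\<^sub>j\<close> for \<open>j \<noteq> i\<close>.\<close>

lemma genericity_sufficient:
  fixes c :: "nat \<times> nat \<times> nat \<Rightarrow> 'k::field_char_0"
  assumes n: "n \<ge> 2" and gen: "genericity n s t p q c \<noteq> 0"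
  shows "\<exists>T a. adapted_coords n (tuple_of_frame n c) T a"
proof -
  let ?X = "pencil_mat n c s t"
  let ?Y = "pencil c p q"
  have d: "det ?X \<noteq> 0" and m: "\<And>i j. i \<le> n \<Longrightarrow> j \<le> n \<Longrightarrow> i \<noteq> j \<Longrightarrow> det (subst_row ?X j (?Y i)) \<noteq> 0"
    using gen by (auto simp: genericity_nonzero_iff)
  have X_index: "?X $$ (i, j) = pencil c s t i j" if "i \<le> n" "j \<le> n" for i j
    using that by (simp add: pencil_mat_def)
  obtain X' where X': "X' \<in> carrier_mat (n + 1) (n + 1)" "?X * X' = 1\<^sub>m (n + 1)" "X' * ?X = 1\<^sub>m (n + 1)"
    using det_nonzero_inverse[OF pencil_mat_carrier d] .
  have "\<exists>coef. \<forall>k<n + 1. ?Y i k = (\<Sum>r<n + 1. coef r * ?X $$ (r, k))" for i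
    using det_nonzero_combination[OF pencil_mat_carrier d] by metis
  then obtain a where a: "\<And>i k. k < n + 1 \<Longrightarrow> ?Y i k = (\<Sum>r<n + 1. a i r * ?X $$ (r, k))"
    by metis
  have a_le: "?Y i k = (\<Sum>r\<le>n. a i r * ?X $$ (r, k))" if "k \<le> n" for i k
    using a[of k i] that unfolding atMost_eq_lessThan by simp
  have sub: "det (subst_row ?X j (?Y i)) = a i j * det ?X" if "j \<le> n" for i j
    using that a by (intro det_subst_row_combination[OF pencil_mat_carrier]) auto
  have nz: "a i j \<noteq> 0" if "i \<le> n" "j \<le> n" "i \<noteq> j" for i j
    using m[OF that] sub[OF that(2), of i] by auto
  have indep: "s i * q i - t i * p i \<noteq> 0" if i: "i \<le> n" for i
  proof
    assume D: "s i * q i - t i * p i = 0"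
    have "card ({..n} - {i}) \<ge> 2" using n i by simp
    then obtain j where "j \<in> {..n} - {i}" by (metis all_not_in_conv card.empty not_numeral_le_zero)
    then have j: "j \<le> n" "j \<noteq> i" by auto
    \<comment> \<open>a relation \<open>x f\<^sub>i = y x\<^sub>i\<close>, compared at the coordinate \<open>x\<^sub>j\<close>\<close>
    have scale: "x * a i j = 0" if eq: "\<And>k. x * ?Y i k = y * pencil c s t i k" for x y
    proof -
      have "det (subst_row ?X j (\<lambda>k. x * ?Y i k)) = (x * a i j) * det ?X"
        using j by (intro det_subst_row_combination[OF pencil_mat_carrier, where coef = "\<lambda>r. x * a i r"])
          (simp_all only: a sum_distrib_left mult.assoc)
      moreover have "det (subst_row ?X j (\<lambda>k. x * ?Y i k)) = (if j = i then y else 0) * det ?X"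
        unfolding eq using i j
        by (intro det_subst_row_combination[OF pencil_mat_carrier, where coef = "\<lambda>r. if r = i then y else 0"])
          (auto simp: X_index if_distrib[of "\<lambda>x. x * _"] cong: if_cong)
      ultimately show ?thesis using j d by auto
    qed
    have "s i * ?Y i k = p i * pencil c s t i k" "t i * ?Y i k = q i * pencil c s t i k" for k
    proof -
      have "s i * ?Y i k - p i * pencil c s t i k = (s i * q i - t i * p i) * c (i, 1, k)"
        "t i * ?Y i k - q i * pencil c s t i k = - (s i * q i - t i * p i) * c (i, 0, k)"
        by (simp_all add: pencil_def algebra_simps)
      then show "s i * ?Y i k = p i * pencil c s t i k" "t i * ?Y i k = q i * pencil c s t i k"
        unfolding D by simp_all
    qed
    then have "s i * a i j = 0" "t i * a i j = 0" using scale by blast+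
    then have "s i = 0" "t i = 0" using nz i j by auto
    then have "?X $$ (i, k) = 0" if "k < n + 1" for k
      using i that by (simp add: X_index pencil_def)
    then have "det ?X = 0"
      using i by (subst laplace_expansion_row[OF pencil_mat_carrier, of i]) auto
    with d show False by simp
  qed
  have plane: "coord_change n ?X ` tuple_of_frame n c i = weight_plane n a i" if i: "i \<le> n" for i
  proof -
    have Xz: "coord_change n ?X z i = to_ac (s i) * (\<Sum>j\<le>n. to_ac (c (i, 0, j)) * z j)
        + to_ac (t i) * (\<Sum>j\<le>n. to_ac (c (i, 1, j)) * z j)" for z
      using i by (simp add: coord_change_def X_index pencil_sum)
    have Yz: "to_ac (p i) * (\<Sum>j\<le>n. to_ac (c (i, 0, j)) * z j)
        + to_ac (q i) * (\<Sum>j\<le>n. to_ac (c (i, 1, j)) * z j)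
        = to_ac (a i i) * coord_change n ?X z i + (\<Sum>r\<in>{..n} - {i}. to_ac (a i r) * coord_change n ?X z r)" for z
    proof -
      have "(\<Sum>j\<le>n. to_ac (?Y i j) * z j) = (\<Sum>j\<le>n. \<Sum>r\<le>n. to_ac (a i r) * (to_ac (?X $$ (r, j)) * z j))"
        by (intro sum.cong) (auto simp: a_le to_ac_sum sum_distrib_right mult.assoc)
      also have "\<dots> = (\<Sum>r\<le>n. to_ac (a i r) * coord_change n ?X z r)"
        by (subst sum.swap) (simp add: coord_change_def sum_distrib_left)
      also have "\<dots> = to_ac (a i i) * coord_change n ?X z i + (\<Sum>r\<in>{..n} - {i}. to_ac (a i r) * coord_change n ?X z r)"
        using i by (subst sum.remove[of _ i]) auto
      finally show ?thesis by (simp add: pencil_sum)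
    qed
    show ?thesis
    proof (intro subset_antisym subsetI)
      fix w assume "w \<in> coord_change n ?X ` tuple_of_frame n c i"
      then obtain z where z: "z \<in> tuple_of_frame n c i" "w = coord_change n ?X z" by blast
      then show "w \<in> weight_plane n a i"
        using Xz[of z] Yz[of z] coord_change_proj[OF pencil_mat_carrier X'(1,3)]
        by (auto simp: tuple_of_frame_iff[OF i] weight_plane_def)
    next
      fix w assume w: "w \<in> weight_plane n a i"
      define z where "z = coord_change n X' w"
      have wp: "w \<in> proj_points n" using w by (simp add: weight_plane_def)
      have zp: "z \<in> proj_points n"
        unfolding z_def by (rule coord_change_proj[OF X'(1) pencil_mat_carrier X'(2) wp])
      have zw: "coord_change n ?X z = w"
        unfolding z_def coord_change_comp[OF pencil_mat_carrier X'(1)] X'(2) by (rule coord_change_one[OF wp])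
      define L M where "L = (\<Sum>j\<le>n. to_ac (c (i, 0, j)) * z j)" and "M = (\<Sum>j\<le>n. to_ac (c (i, 1, j)) * z j)"
      have e: "to_ac (s i) * L + to_ac (t i) * M = 0" "to_ac (p i) * L + to_ac (q i) * M = 0"
        using w Xz[of z] Yz[of z] unfolding L_def M_def zw by (simp_all add: weight_plane_def)
      have "to_ac (s i * q i - t i * p i) * L = to_ac (q i) * (to_ac (s i) * L + to_ac (t i) * M)
          - to_ac (t i) * (to_ac (p i) * L + to_ac (q i) * M)"
        "to_ac (s i * q i - t i * p i) * M = to_ac (s i) * (to_ac (p i) * L + to_ac (q i) * M)
          - to_ac (p i) * (to_ac (s i) * L + to_ac (t i) * M)"
        by (simp_all add: algebra_simps)
      then have "to_ac (s i * q i - t i * p i) * L = 0" "to_ac (s i * q i - t i * p i) * M = 0"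
        unfolding e by simp_all
      then have "L = 0" "M = 0" using indep[OF i] by (simp_all only: mult_eq_0_iff to_ac_eq_0_iff) auto
      then have "z \<in> tuple_of_frame n c i"
        using zp by (simp add: tuple_of_frame_iff[OF i] L_def M_def)
      then show "w \<in> coord_change n ?X ` tuple_of_frame n c i" using zw by blast
    qed
  qed
  have "invertible_mat ?X"
    unfolding invertible_mat_def inverts_mat_def
    using X' by (auto simp: square_mat.simps pencil_mat_def intro!: exI[of _ X'])
  then have "adapted_coords n (tuple_of_frame n c) ?X a"
    unfolding adapted_coords_def
  proof (intro conjI allI impI)
    fix i assume i: "i \<le> n"
    show "vanishing_ideal n (coord_change n ?X ` tuple_of_frame n c i) = ideal_of_two n (Var i) (f_form n a i)"
      unfolding plane[OF i] by (rule vanishing_ideal_weight_plane[OF n i]) (rule nz[OF i], auto)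
  qed (use nz pencil_mat_carrier[of n c s t] in auto)
  then show ?thesis by blast
qed

text \<open>Pulled back to the given coordinates, the generators \<open>x\<^sub>i\<close> and \<open>f\<^sub>i\<close> of the ideal vanish on the
  \<open>i\<close>-th subspace, so they are members of the \<open>i\<close>-th pencil; their parameters are the required ones.\<close>

lemma genericity_necessary:
  fixes c :: "nat \<times> nat \<times> nat \<Rightarrow> 'k::field_char_0"
  assumes c: "c \<in> frames n" and ad: "adapted_coords n (tuple_of_frame n c) T a"
  shows "\<exists>s t p q. genericity n s t p q c \<noteq> 0"
proof -
  have T: "T \<in> carrier_mat (n + 1) (n + 1)" and inv: "invertible_mat T"
    and van: "\<And>i. i \<le> n \<Longrightarrow> vanishing_ideal n (coord_change n T ` tuple_of_frame n c i)
              = ideal_of_two n (Var i) (f_form n a i)"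
    and nz: "\<And>i j. i \<le> n \<Longrightarrow> j \<le> n \<Longrightarrow> i \<noteq> j \<Longrightarrow> a i j \<noteq> 0"
    using ad by (auto simp: adapted_coords_def)
  define Y where "Y i k = (\<Sum>r\<in>{..n} - {i}. a i r * T $$ (r, k))" for i k
  have span: "\<exists>x y. \<forall>j\<le>n. r j = x * c (i, 0, j) + y * c (i, 1, j)"
    if i: "i \<le> n" and r: "\<And>z. z \<in> tuple_of_frame n c i \<Longrightarrow> (\<Sum>j\<le>n. to_ac (r j) * z j) = 0" for i r
    using c i r by (intro vanishing_linear_form) (auto simp: frames_def tuple_of_frame_def)
  have ideal0: "mpeval to_ac (coord_change n T z) F = 0"
    if "i \<le> n" "z \<in> tuple_of_frame n c i" "F \<in> ideal_of_two n (Var i) (f_form n a i)" for i z F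
    using that unfolding van[OF that(1), symmetric] by (auto simp: vanishing_ideal_def)
  have "\<exists>x y. \<forall>j\<le>n. T $$ (i, j) = x * c (i, 0, j) + y * c (i, 1, j)" if i: "i \<le> n" for i
  proof (rule span[OF i])
    fix z assume "z \<in> tuple_of_frame n c i"
    from ideal0[OF i this ideal_of_two_left] show "(\<Sum>j\<le>n. to_ac (T $$ (i, j)) * z j) = 0"
      using i by (simp add: coord_change_def)
  qed
  then obtain s t where st: "\<And>i j. i \<le> n \<Longrightarrow> j \<le> n \<Longrightarrow> T $$ (i, j) = pencil c s t i j"
    unfolding pencil_def by metis
  have "\<exists>x y. \<forall>j\<le>n. Y i j = x * c (i, 0, j) + y * c (i, 1, j)" if i: "i \<le> n" for i
  proof (rule span[OF i])
    fix z assume "z \<in> tuple_of_frame n c i"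
    from ideal0[OF i this ideal_of_two_right]
    have "0 = (\<Sum>r\<in>{..n} - {i}. to_ac (a i r) * coord_change n T z r)"
      by (simp add: f_form_def ev_ac.hom_sum ev_ac.hom_mult)
    also have "\<dots> = (\<Sum>r\<in>{..n} - {i}. \<Sum>j\<le>n. to_ac (a i r * T $$ (r, j)) * z j)"
      by (intro sum.cong) (auto simp: coord_change_def sum_distrib_left mult.assoc)
    also have "\<dots> = (\<Sum>j\<le>n. to_ac (Y i j) * z j)"
      by (subst sum.swap) (simp add: Y_def to_ac_sum sum_distrib_right)
    finally show "(\<Sum>j\<le>n. to_ac (Y i j) * z j) = 0" by simp
  qed
  then obtain p q where pq: "\<And>i j. i \<le> n \<Longrightarrow> j \<le> n \<Longrightarrow> Y i j = pencil c p q i j"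
    unfolding pencil_def by metis
  have TX: "pencil_mat n c s t = T"
    by (rule eq_matI) (use T st in \<open>auto simp: pencil_mat_def\<close>)
  obtain T' where T'1: "T * T' = 1\<^sub>m (n + 1)" and T'2: "T' * T = 1\<^sub>m (dim_row T')"
    using inv T by (auto simp: invertible_mat_def inverts_mat_def)
  have "dim_col T' = n + 1" "dim_row T' = n + 1"
    using arg_cong[OF T'1, of dim_col] arg_cong[OF T'2, of dim_col] T by simp_all
  then have T': "T' \<in> carrier_mat (n + 1) (n + 1)" by (rule carrier_matI[rotated])
  have "det T * det T' = 1" using det_mult[OF T T'] T'1 by simp
  then have d: "det T \<noteq> 0" by auto
  have "det (subst_row T j (pencil c p q i)) \<noteq> 0" if "i \<le> n" "j \<le> n" "i \<noteq> j" for i j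
  proof -
    have "pencil c p q i k = (\<Sum>r<n + 1. (if r = i then 0 else a i r) * T $$ (r, k))" if "k < n + 1" for k
      using that \<open>i \<le> n\<close> by (subst lessThan_Suc_split[of i]) (auto simp: Y_def intro!: sum.cong simp flip: pq)
    then have "det (subst_row T j (pencil c p q i)) = (if j = i then 0 else a i j) * det T"
      using that by (intro det_subst_row_combination[OF T]) auto
    then show ?thesis using that nz d by simp
  qed
  with d have "genericity n s t p q c \<noteq> 0" by (simp add: genericity_nonzero_iff TX)
  then show ?thesis by blast
qed

section \<open>Openness and density\<close>

text \<open>Open sets are defined by values of polynomials, so closure properties of polynomial functions replace
  an explicit genericity polynomial.\<close>

definition polyfun :: "(('v \<Rightarrow> 'k) \<Rightarrow> 'k::comm_ring_1) \<Rightarrow> bool" where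
  "polyfun f \<longleftrightarrow> (\<exists>F. \<forall>c. mpeval (\<lambda>a. a) c F = f c)"

lemma polyfun_const: "polyfun (\<lambda>_. k)"
  unfolding polyfun_def by (rule exI[of _ "Cst k"]) simp

lemma polyfun_var: "polyfun (\<lambda>c. c v)"
  unfolding polyfun_def by (rule exI[of _ "Var v"]) simp

lemma polyfun_add: "polyfun f \<Longrightarrow> polyfun g \<Longrightarrow> polyfun (\<lambda>c. f c + g c)"
  unfolding polyfun_def using ev.hom_add by metis

lemma polyfun_mult: "polyfun f \<Longrightarrow> polyfun g \<Longrightarrow> polyfun (\<lambda>c. f c * g c)"
  unfolding polyfun_def using ev.hom_mult by metis

lemma polyfun_diff: "polyfun f \<Longrightarrow> polyfun g \<Longrightarrow> polyfun (\<lambda>c. f c - g c)"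
  unfolding polyfun_def using ev.hom_minus by metis

lemma polyfun_sum: "(\<And>x. x \<in> S \<Longrightarrow> polyfun (\<lambda>c. f c x)) \<Longrightarrow> polyfun (\<lambda>c. \<Sum>x\<in>S. f c x)"
  by (induction S rule: infinite_finite_induct) (auto intro: polyfun_const polyfun_add)

lemma polyfun_prod: "(\<And>x. x \<in> S \<Longrightarrow> polyfun (\<lambda>c. f c x)) \<Longrightarrow> polyfun (\<lambda>c. \<Prod>x\<in>S. f c x)"
  by (induction S rule: infinite_finite_induct) (auto intro: polyfun_const polyfun_mult)

lemma polyfun_det:
  assumes M: "\<And>c. M c \<in> carrier_mat N N"
    and e: "\<And>i j. i < N \<Longrightarrow> j < N \<Longrightarrow> polyfun (\<lambda>c. M c $$ (i, j))"
  shows "polyfun (\<lambda>c. det (M c))"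
  unfolding det_def'[OF M]
proof (intro polyfun_sum polyfun_mult polyfun_const polyfun_prod e)
  fix p i assume "p \<in> {p. p permutes {0..<N}}" "i \<in> {0..<N}"
  then show "p i < N" using permutes_in_image[of p "{0..<N}" i] by simp
qed auto

lemma polyfun_genericity: "polyfun (genericity n s t p q)"
proof -
  have pencil: "polyfun (\<lambda>c. pencil c x y i j)" for x y i j
    unfolding pencil_def by (intro polyfun_add polyfun_mult polyfun_const polyfun_var)
  have mat: "polyfun (\<lambda>c. pencil_mat n c s t $$ (i, j))" if "i < n + 1" "j < n + 1" for i j
    using that pencil by (simp add: pencil_mat_def)
  have "polyfun (\<lambda>c. subst_row (pencil_mat n c s t) k (pencil c p q l) $$ (i, j))"
    if "i < n + 1" "j < n + 1" for i j k l
    using that pencil mat[OF that] by (cases "i = k") (simp_all add: subst_row_def pencil_mat_def)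
  then show ?thesis
    unfolding genericity_def
    by (intro polyfun_mult polyfun_prod polyfun_det[of _ "n + 1"] mat) (auto simp: subst_row_def pencil_mat_def)
qed

lemma polyfun_on_line:
  fixes f :: "('v \<Rightarrow> 'k::comm_ring_1) \<Rightarrow> 'k"
  assumes "polyfun f"
  obtains u where "\<And>\<tau>. poly u \<tau> = f (\<lambda>v. c v + \<tau> * d v)"
proof -
  obtain F where F: "\<And>c. mpeval (\<lambda>a. a) c F = f c" using assms unfolding polyfun_def by blast
  define u where "u = mpeval (\<lambda>k. [:k:]) (\<lambda>v. [:c v, d v:]) F"
  have "poly u \<tau> = f (\<lambda>v. c v + \<tau> * d v)" for \<tau>
  proof -
    have h: "comm_ring_hom (\<lambda>p::'k poly. poly p \<tau>)" by standard simp_all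
    show ?thesis
      unfolding u_def comm_ring_hom.hom_mpeval[OF h] by (simp flip: F)
  qed
  then show ?thesis by (rule that)
qed

lemma tuple_of_frame_in_tuples: "c \<in> frames n \<Longrightarrow> tuple_of_frame n c \<in> tuples n"
  unfolding tuples_def tuple_of_frame_def restrict_PiE_iff
proof
  fix i assume "c \<in> frames n" "i \<in> {..n}"
  then have "lin_indep2 n (\<lambda>j. c (i, 0, j)) (\<lambda>j. c (i, 1, j))" by (simp add: frames_def)
  then show "zero_locus n {lin_form n (\<lambda>j. c (i, 0, j)), lin_form n (\<lambda>j. c (i, 1, j))} \<in> codim2_subspaces n"
    unfolding codim2_subspaces_def by blast
qed

lemma frame_exists:
  assumes "P \<in> tuples n"
  obtains c where "c \<in> frames n" "tuple_of_frame n c = P"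
proof -
  have "\<exists>l m. lin_indep2 n l m \<and> P i = zero_locus n {lin_form n l, lin_form n m}" if "i \<le> n" for i
    using assms that by (force simp: tuples_def codim2_subspaces_def)
  then obtain l m where lm: "\<And>i. i \<le> n \<Longrightarrow> lin_indep2 n (l i) (m i)"
    "\<And>i. i \<le> n \<Longrightarrow> P i = zero_locus n {lin_form n (l i), lin_form n (m i)}"
    by metis
  define c where "c = (\<lambda>(i, e, j). if i \<le> n \<and> j \<le> n then if e = 0 then l i j
    else if e = (1::nat) then m i j else 0 else 0)"
  have "c \<in> frames n"
    unfolding frames_def
  proof (intro CollectI conjI allI impI)
    fix v :: "nat \<times> nat \<times> nat" assume "v \<notin> {..n} \<times> {..1} \<times> {..n}"
    then show "c v = 0" by (cases v) (auto simp: c_def)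
  next
    fix i assume i: "i \<le> n"
    show "lin_indep2 n (\<lambda>j. c (i, 0, j)) (\<lambda>j. c (i, 1, j))"
      unfolding lin_indep2_def
    proof (intro allI impI)
      fix x y assume "\<forall>j\<le>n. x * c (i, 0, j) + y * c (i, 1, j) = 0"
      then have "\<forall>j\<le>n. x * l i j + y * m i j = 0" using i by (simp add: c_def)
      with lm(1)[OF i] show "x = 0 \<and> y = 0" unfolding lin_indep2_def by blast
    qed
  qed
  moreover have "lin_form n (\<lambda>j. c (i, 0, j)) = lin_form n (l i)" "lin_form n (\<lambda>j. c (i, 1, j)) = lin_form n (m i)"
    if "i \<le> n" for i
    using that by (auto simp: lin_form_def c_def intro!: sum.cong)
  then have "tuple_of_frame n c = P"
    using assms lm(2) by (auto simp: tuple_of_frame_def tuples_def fun_eq_iff intro: PiE_arb[symmetric])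
  ultimately show ?thesis by (rule that)
qed

text \<open>The subspaces \<open>x\<^sub>i = \<Sum>\<^sub>j\<^sub>\<noteq>\<^sub>i x\<^sub>j = 0\<close>.\<close>

definition coordinate_frame :: "nat \<Rightarrow> nat \<times> nat \<times> nat \<Rightarrow> 'k::zero_neq_one" where
  "coordinate_frame n = (\<lambda>(i, e, j). if i \<le> n \<and> j \<le> n \<and> e \<le> 1 \<and> (i = j \<longleftrightarrow> e = 0) then 1 else 0)"

lemma genericity_coordinate_frame:
  "genericity n (\<lambda>_. 1) (\<lambda>_. 0) (\<lambda>_. 0) (\<lambda>_. 1) (coordinate_frame n :: _ \<Rightarrow> 'k::field) \<noteq> 0"
proof -
  let ?X = "pencil_mat n (coordinate_frame n :: _ \<Rightarrow> 'k) (\<lambda>_. 1) (\<lambda>_. 0)"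
  have X: "?X = 1\<^sub>m (n + 1)"
    by (rule eq_matI) (auto simp: pencil_mat_def pencil_def coordinate_frame_def)
  have "det (subst_row (1\<^sub>m (n + 1)) j (pencil (coordinate_frame n) (\<lambda>_. 0) (\<lambda>_. 1) i)) =
      (if j = i then 0 else 1) * det (1\<^sub>m (n + 1) :: 'k mat)" if "i \<le> n" "j \<le> n" for i j
    using that
    by (intro det_subst_row_combination[where coef = "\<lambda>r. if r = i then 0 else 1"])
      (auto simp: pencil_def coordinate_frame_def if_distrib[of "\<lambda>x. _ * x"] cong: if_cong)
  then show ?thesis unfolding genericity_nonzero_iff X by simp
qed

definition generic_tuples :: "nat \<Rightarrow> (nat \<Rightarrow> (nat \<Rightarrow> 'k::field_char_0 alg_closure) set) set" where
  "generic_tuples n = {P \<in> tuples n. \<exists>T a. adapted_coords n P T a}"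

lemma frame_generic_iff:
  fixes c :: "nat \<times> nat \<times> nat \<Rightarrow> 'k::field_char_0"
  assumes "n \<ge> 2" "c \<in> frames n"
  shows "tuple_of_frame n c \<in> generic_tuples n \<longleftrightarrow> (\<exists>s t p q. genericity n s t p q c \<noteq> 0)"
proof
  assume "tuple_of_frame n c \<in> generic_tuples n"
  then obtain T a where "adapted_coords n (tuple_of_frame n c) T a"
    unfolding generic_tuples_def by blast
  then show "\<exists>s t p q. genericity n s t p q c \<noteq> 0" by (rule genericity_necessary[OF assms(2)])
next
  assume "\<exists>s t p q. genericity n s t p q c \<noteq> 0"
  then show "tuple_of_frame n c \<in> generic_tuples n"
    using genericity_sufficient[OF assms(1)] tuple_of_frame_in_tuples[OF assms(2)]
    by (auto simp: generic_tuples_def)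
qed

lemma generic_tuples_open:
  assumes n: "n \<ge> 2"
  shows "zariski_open n (generic_tuples n :: (nat \<Rightarrow> (nat \<Rightarrow> 'k::field_char_0 alg_closure) set) set)"
  unfolding zariski_open_def
proof
  show "generic_tuples n \<subseteq> tuples n" by (auto simp: generic_tuples_def)
  let ?S = "{F :: (nat \<times> nat \<times> nat, 'k) mpoly.
    \<exists>s t p q. \<forall>c. mpeval (\<lambda>a. a) c F = genericity n s t p q c}"
  have S: "(\<exists>F\<in>?S. mpeval (\<lambda>a. a) c F \<noteq> 0) \<longleftrightarrow> (\<exists>s t p q. genericity n s t p q c \<noteq> 0)" for c
  proof
    assume "\<exists>s t p q. genericity n s t p q c \<noteq> 0"
    then obtain s t p q where g: "genericity n s t p q c \<noteq> 0" by blast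
    obtain F where "\<And>c. mpeval (\<lambda>a. a) c F = genericity n s t p q c"
      using polyfun_genericity unfolding polyfun_def by blast
    then have "F \<in> ?S" "mpeval (\<lambda>a. a) c F \<noteq> 0" using g by (blast, metis)
    then show "\<exists>F\<in>?S. mpeval (\<lambda>a. a) c F \<noteq> 0" by blast
  next
    assume "\<exists>F\<in>?S. mpeval (\<lambda>a. a) c F \<noteq> 0"
    then obtain F s t p q where "mpeval (\<lambda>a. a) c F \<noteq> 0"
      "\<forall>c. mpeval (\<lambda>a. a) c F = genericity n s t p q c" by blast
    then have "genericity n s t p q c \<noteq> 0" by metis
    then show "\<exists>s t p q. genericity n s t p q c \<noteq> 0" by blast
  qed
  have "{c \<in> frames n. tuple_of_frame n c \<in> generic_tuples n} =
      {c \<in> frames n. \<exists>F\<in>?S. mpeval (\<lambda>a. a) c F \<noteq> 0}"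
    by (intro Collect_cong conj_cong refl) (simp only: frame_generic_iff[OF n] S)
  then show "\<exists>S :: (nat \<times> nat \<times> nat, 'k) mpoly set.
      {c \<in> frames n. tuple_of_frame n c \<in> generic_tuples n} =
      {c \<in> frames n. \<exists>F\<in>S. mpeval (\<lambda>a. a) c F \<noteq> 0}" by blast
qed

text \<open>On the line through a frame of a given nonempty open set and the coordinate frame, a polynomial
  defining that set, the genericity polynomial and the minors witnessing linear independence each
  vanish at finitely many parameters only.\<close>

lemma generic_tuples_dense:
  assumes n: "n \<ge> 2"
  shows "zariski_dense n (generic_tuples n :: (nat \<Rightarrow> (nat \<Rightarrow> 'k::field_char_0 alg_closure) set) set)"
  unfolding zariski_dense_def
proof (intro allI impI)
  fix V :: "(nat \<Rightarrow> (nat \<Rightarrow> 'k alg_closure) set) set"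
  assume V: "zariski_open n V \<and> V \<noteq> {}"
  then obtain S :: "(nat \<times> nat \<times> nat, 'k) mpoly set" where VT: "V \<subseteq> tuples n" and
    S: "{c \<in> frames n. tuple_of_frame n c \<in> V} = {c \<in> frames n. \<exists>F\<in>S. mpeval (\<lambda>a. a) c F \<noteq> 0}"
    unfolding zariski_open_def by blast
  from V obtain P where P: "P \<in> V" by blast
  with VT obtain c where c: "c \<in> frames n" "tuple_of_frame n c = P" by (blast intro: frame_exists)
  with P S obtain G where G: "G \<in> S" "mpeval (\<lambda>a. a) c G \<noteq> 0" by blast
  have "\<forall>i\<le>n. \<exists>j1 j2. j1 \<le> n \<and> j2 \<le> n \<and>
      c (i, 0, j1) * c (i, 1, j2) - c (i, 0, j2) * c (i, 1, j1) \<noteq> 0"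
  proof (intro allI impI)
    fix i assume "i \<le> n"
    then have "lin_indep2 n (\<lambda>j. c (i, 0, j)) (\<lambda>j. c (i, 1, j))"
      using c(1) by (simp add: frames_def)
    then show "\<exists>j1 j2. j1 \<le> n \<and> j2 \<le> n \<and>
      c (i, 0, j1) * c (i, 1, j2) - c (i, 0, j2) * c (i, 1, j1) \<noteq> 0"
      by (rule lin_indep2_minor) blast
  qed
  then obtain J1 J2 where J: "\<And>i. i \<le> n \<Longrightarrow> J1 i \<le> n" "\<And>i. i \<le> n \<Longrightarrow> J2 i \<le> n"
    and Jc: "\<And>i. i \<le> n \<Longrightarrow> c (i, 0, J1 i) * c (i, 1, J2 i) - c (i, 0, J2 i) * c (i, 1, J1 i) \<noteq> 0"
    by metis
  define H :: "(nat \<times> nat \<times> nat \<Rightarrow> 'k) \<Rightarrow> 'k" where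
    "H x = (\<Prod>i\<le>n. x (i, 0, J1 i) * x (i, 1, J2 i) - x (i, 0, J2 i) * x (i, 1, J1 i))" for x
  have H: "polyfun H"
    unfolding H_def by (intro polyfun_prod polyfun_diff polyfun_mult polyfun_var)
  define gen :: "(nat \<times> nat \<times> nat \<Rightarrow> 'k) \<Rightarrow> 'k" where
    "gen = genericity n (\<lambda>_. 1) (\<lambda>_. 0) (\<lambda>_. 0) (\<lambda>_. 1)"
  define d where "d v = coordinate_frame n v - c v" for v
  define line where "line \<tau> = (\<lambda>v. c v + \<tau> * d v)" for \<tau>
  have line0: "line 0 = c" and line1: "line 1 = coordinate_frame n"
    by (simp_all add: line_def d_def)
  obtain uG where uG: "\<And>\<tau>. poly uG \<tau> = mpeval (\<lambda>a. a) (line \<tau>) G"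
    using polyfun_on_line[of "\<lambda>x. mpeval (\<lambda>a. a) x G" c d] unfolding line_def polyfun_def by blast
  obtain uH where uH: "\<And>\<tau>. poly uH \<tau> = H (line \<tau>)"
    using polyfun_on_line[OF H] unfolding line_def by metis
  obtain ug where ug: "\<And>\<tau>. poly ug \<tau> = gen (line \<tau>)"
    using polyfun_on_line[OF polyfun_genericity] unfolding line_def gen_def by metis
  have "poly uG 0 \<noteq> 0" using G uG line0 by simp
  moreover have "poly uH 0 \<noteq> 0" using Jc by (simp add: uH line0 H_def)
  moreover have "poly ug 1 \<noteq> 0"
    unfolding ug line1 gen_def by (rule genericity_coordinate_frame)
  ultimately have "uG * uH * ug \<noteq> 0" by auto
  then have "finite {\<tau>. poly (uG * uH * ug) \<tau> = 0}" by (rule poly_roots_finite)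
  then obtain \<tau> where \<tau>: "poly (uG * uH * ug) \<tau> \<noteq> 0"
    using infinite_UNIV_char_0[where 'a = 'k] by (metis (mono_tags, lifting) UNIV_eq_I mem_Collect_eq)
  then have nz: "mpeval (\<lambda>a. a) (line \<tau>) G \<noteq> 0" "H (line \<tau>) \<noteq> 0" "gen (line \<tau>) \<noteq> 0"
    by (simp_all add: uG uH ug)
  have fr: "line \<tau> \<in> frames n"
    unfolding frames_def
  proof (intro CollectI conjI allI impI)
    fix v :: "nat \<times> nat \<times> nat" assume "v \<notin> {..n} \<times> {..1} \<times> {..n}"
    then show "line \<tau> v = 0"
      using c(1) by (auto simp: frames_def line_def d_def coordinate_frame_def split: prod.splits)
  next
    fix i assume i: "i \<le> n"
    show "lin_indep2 n (\<lambda>j. line \<tau> (i, 0, j)) (\<lambda>j. line \<tau> (i, 1, j))"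
      by (rule lin_indep2_if_minor[OF J[OF i]]) (use nz(2) i in \<open>simp add: H_def\<close>)
  qed
  have "tuple_of_frame n (line \<tau>) \<in> V" using S fr nz(1) G(1) by blast
  moreover have "tuple_of_frame n (line \<tau>) \<in> generic_tuples n"
    using frame_generic_iff[OF n fr] nz(3) unfolding gen_def by blast
  ultimately show "generic_tuples n \<inter> V \<noteq> {}" by blast
qed

theorem mainTheorem8:
  fixes n :: nat
  assumes "n \<ge> 2"
  shows "\<exists>U :: (nat \<Rightarrow> (nat \<Rightarrow> 'k::field_char_0 alg_closure) set) set.
    zariski_open n U \<and> zariski_dense n U \<and>
    (\<forall>P\<in>U.
      (\<exists>T a. adapted_coords n P T a) \<and>
      (\<forall>T a. adapted_coords n P T a \<longrightarrow>
        (\<forall>i\<le>n. Q_form n a i \<in> forms n (n - 1) \<and>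
               det (mat_delete (B_mat n a) i i) = Var i * Q_form n a i \<and>
               (\<exists>!\<beta>. is_b_row n a i \<beta>)) \<and>
        (\<forall>k\<le>n. Pi_star n a k \<in> codim2_subspaces n) \<and>
        mutually_inverse n (u_map n a) (v_map n a) \<and>
        (\<forall>i\<le>n. u_map n a i \<in> forms n n \<and> u_map n a i \<noteq> 0 \<and>
          (\<forall>k\<le>n. \<forall>p\<in>Pi_star n a k. mpeval to_ac p (u_map n a i) = 0))))"
proof (intro exI[of _ "generic_tuples n"] conjI ballI)
  show "zariski_open n (generic_tuples n)" by (rule generic_tuples_open[OF assms])
  show "zariski_dense n (generic_tuples n)" by (rule generic_tuples_dense[OF assms])
next
  fix P :: "nat \<Rightarrow> (nat \<Rightarrow> 'k alg_closure) set"
  assume "P \<in> generic_tuples n"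
  then show "\<exists>T a. adapted_coords n P T a" by (simp add: generic_tuples_def)
next
  fix P :: "nat \<Rightarrow> (nat \<Rightarrow> 'k alg_closure) set"
  show "\<forall>T a. adapted_coords n P T a \<longrightarrow>
        (\<forall>i\<le>n. Q_form n a i \<in> forms n (n - 1) \<and>
               det (mat_delete (B_mat n a) i i) = Var i * Q_form n a i \<and>
               (\<exists>!\<beta>. is_b_row n a i \<beta>)) \<and>
        (\<forall>k\<le>n. Pi_star n a k \<in> codim2_subspaces n) \<and>
        mutually_inverse n (u_map n a) (v_map n a) \<and>
        (\<forall>i\<le>n. u_map n a i \<in> forms n n \<and> u_map n a i \<noteq> 0 \<and>
          (\<forall>k\<le>n. \<forall>p\<in>Pi_star n a k. mpeval to_ac p (u_map n a i) = 0))"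
  proof (intro allI impI)
    fix T :: "'k mat" and a
    assume "adapted_coords n P T a"
    then interpret weights n a
      using assms by unfold_locales (auto simp: adapted_coords_def)
    show "(\<forall>i\<le>n. Q_form n a i \<in> forms n (n - 1) \<and>
               det (mat_delete (B_mat n a) i i) = Var i * Q_form n a i \<and>
               (\<exists>!\<beta>. is_b_row n a i \<beta>)) \<and>
        (\<forall>k\<le>n. Pi_star n a k \<in> codim2_subspaces n) \<and>
        mutually_inverse n (u_map n a) (v_map n a) \<and>
        (\<forall>i\<le>n. u_map n a i \<in> forms n n \<and> u_map n a i \<noteq> 0 \<and>
          (\<forall>k\<le>n. \<forall>p\<in>Pi_star n a k. mpeval to_ac p (u_map n a i) = 0))"
      using Q_form_forms Q_form_eq det_B_minor is_b_row_iff Pi_star_codim2 mutually_inverse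
        u_map_forms u_map_nonzero u_map_vanishes
      by auto
  qed
qed

end
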